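(* Let $d\ge2$ and $f\in H^\infty(B_d)$. Then there exists a set $\Lambda\subset\mathbb{C}$ such that $\Lambda$ is dense in $f(B_d)$ and the following property holds: for any $a\in\Lambda$, there exists a representing measure $\rho\in\bigcup_{z\in B_d}M_z(S_d)$ such that $\lim_{r\to1-}f_r=a$ in the $\sigma(L^\infty(\rho),L^1(\rho))$-topology.
   Context: $B_d$ is the open unit ball of $\mathbb{C}^d$, $S_d=\partial B_d$; $H^\infty(B_d)$ is the space of bounded holomorphic functions on $B_d$; $f_r(\zeta)=f(r\zeta)$ for $\zeta\in S_d$, $0<r<1$. The ball algebra $A(B_d)$ consists of those $g\in C(\overline{B_d})$ which are holomorphic in $B_d$. For $z\in B_d$, $M_z(S_d)$ is the set of Borel probability measures $\rho$ on $S_d$ which represent $z$ for $A(B_d)$, that is, $\int_{S_d}g\,d\rho=g(z)$ for all $g\in A(B_d)$; such $\rho$ are called representing measures. Convergence $f_r\to a$ in $\sigma(L^\infty(\rho),L^1(\rho))$ means $\int_{S_d}f_r g\,d\rho\to a\int_{S_d}g\,d\rho$ for every $g\in L^1(\rho)$. *)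

theory Defs
  imports "HOL-Analysis.Analysis" "HOL-Probability.Probability"
begin

text \<open>
  \<open>\<complex>\<^sup>d\<close> is modelled by \<^typ>\<open>complex ^ 'd\<close>, whose norm is the Euclidean one; thus
  \<open>B\<^sub>d = ball 0 1\<close> and \<open>S\<^sub>d = sphere 0 1\<close>. A function is holomorphic on an open set
  if it has a complex-linear Frechet derivative at every point.
\<close>

definition holomorphic_cn_on :: "(complex ^ 'd \<Rightarrow> complex) \<Rightarrow> (complex ^ 'd) set \<Rightarrow> bool" where
  "holomorphic_cn_on f U \<longleftrightarrow>
     (\<forall>z\<in>U. \<exists>D. (f has_derivative D) (at z) \<and> (\<forall>c v. D (c *s v) = c * D v))"

definition Hinf :: "(complex ^ 'd \<Rightarrow> complex) set" where
  "Hinf = {f. holomorphic_cn_on f (ball 0 1) \<and> bounded (f ` ball 0 1)}"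

definition ball_algebra :: "(complex ^ 'd \<Rightarrow> complex) set" where
  "ball_algebra = {g. continuous_on (cball 0 1) g \<and> holomorphic_cn_on g (ball 0 1)}"

definition rep_measures :: "complex ^ 'd \<Rightarrow> (complex ^ 'd) measure set" where
  "rep_measures z =
     {\<rho>. sets \<rho> = sets (restrict_space borel (sphere 0 1)) \<and> prob_space \<rho> \<and>
         (\<forall>g\<in>ball_algebra. (LINT \<zeta>|\<rho>. g \<zeta>) = g z)}"

definition dilate :: "(complex ^ 'd \<Rightarrow> complex) \<Rightarrow> real \<Rightarrow> complex ^ 'd \<Rightarrow> complex" where
  "dilate f r \<zeta> = f (r *\<^sub>R \<zeta>)"

text \<open>
  Convergence of a family \<open>F\<close> of bounded measurable functions to \<open>h\<close>, along the filter \<open>\<F>\<close>, in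
  the topology \<open>\<sigma>(L\<^sup>\<infinity>(\<rho>), L\<^sup>1(\<rho>))\<close>.
\<close>

definition weak_star_tendsto ::
  "'a measure \<Rightarrow> ('i \<Rightarrow> 'a \<Rightarrow> complex) \<Rightarrow> ('a \<Rightarrow> complex) \<Rightarrow> 'i filter \<Rightarrow> bool" where
  "weak_star_tendsto \<rho> F h \<F> \<longleftrightarrow>
     (\<forall>g :: 'a \<Rightarrow> complex. integrable \<rho> g \<longrightarrow>
        ((\<lambda>i. LINT x|\<rho>. F i x * g x) \<longlongrightarrow> (LINT x|\<rho>. h x * g x)) \<F>)"

end

theory Submission
  imports Defs "HOL-Complex_Analysis.Complex_Analysis"
begin

text \<open>
  Let \<open>a = f z\<close> with \<open>z\<close> noncritical for \<open>f\<close>. Restricting \<open>f\<close> to a two-dimensional slice through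
  \<open>z\<close>, on which \<open>F\<^sub>y \<noteq> 0\<close> at \<open>z\<close>, run a random walk inside the level set \<open>{F = a, F\<^sub>y \<noteq> 0}\<close>: each step
  goes to a uniformly distributed boundary point of an analytic disc in the level set centred at
  the current position. Holomorphic functions become martingales along this walk, so it converges in
  \<open>L\<^sup>2\<close> and its steps tend to 0; hence it cannot converge to an interior point of the level set with
  \<open>F\<^sub>y \<noteq> 0\<close>, where the radii of the discs are bounded below. Nor can it converge to an interior zero of
  \<open>F\<^sub>y\<close>, because \<open>- ln \<bar>F\<^sub>y\<bar>\<close> is a martingale as well. So the limit \<open>X\<^sub>\<infinity>\<close> lies on the sphere, and its law
  represents \<open>z\<close>. For a bounded function \<open>k\<close>, the martingale property gives
  \<open>E (f\<^sub>r(X\<^sub>\<infinity>) k(X\<^sub>n)) = E (f\<^sub>r(X\<^sub>n) k(X\<^sub>n)) \<longlonglongrightarrow> a E (k(X\<^sub>n))\<close> as \<open>r \<longlonglongrightarrow> 1\<close>, and letting \<open>n \<longlonglongrightarrow> \<infinity>\<close> yields the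
  weak-star limit \<open>a\<close>. If \<open>f\<close> is not constant, its noncritical points are dense by the identity theorem.
\<close>

section \<open>Random walks with harmonic steps\<close>

text \<open>The obstacle is that a level set may be singular and its behaviour near the sphere is
  unknown, so it cannot be parametrised up to its boundary. Small discs need only local charts, and
  graph charts over the first variable exist exactly where \<open>Fy\<close> does not vanish. The
  set on which the walk lives is therefore not closed in the ball, and \<open>- ln |Fy|\<close>
  serves as a barrier at the missing points: it has the mean value property because
  \<open>Fy\<close> has a holomorphic logarithm on every chart. It is bounded below only on smaller
  balls, since \<open>Fy\<close> may be unbounded near the sphere. Hence the walk is stopped at a
  radius \<open>R < \<rho>\<close>, with a separate estimate for returns from outside. No
  filtrations or conditional expectations occur. A position is a function of the start and of a
  stream of independent noises, and every martingale statement is proved by splitting off the first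
  noise. Almost sure convergence is needed only along a subsequence, where it follows from the
  Cauchy property in the mean. Dimension at least two gives the level set room for nonconstant
  discs.\<close>

lemma (in prob_space) stream_space_eq_distr_pair:
  "stream_space M = distr (M \<Otimes>\<^sub>M stream_space M) (stream_space M) (\<lambda>(x, \<omega>). x ## \<omega>)"
proof (rule measure_eqI)
  interpret S: prob_space "stream_space M" by (rule prob_space_stream_space)
  fix A assume A: "A \<in> sets (stream_space M)"
  note A[measurable]
  have "emeasure (stream_space M) A = (\<integral>\<^sup>+x. (\<integral>\<^sup>+\<omega>. indicator A (x ## \<omega>) \<partial>stream_space M) \<partial>M)"
    using nn_integral_stream_space[of "indicator A"] A by simp
  also have "\<dots> = (\<integral>\<^sup>+z. indicator A (case z of (x, \<omega>) \<Rightarrow> x ## \<omega>) \<partial>(M \<Otimes>\<^sub>M stream_space M))"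
    by (subst S.nn_integral_fst[symmetric]) auto
  also have "\<dots> = (\<integral>\<^sup>+z. indicator A z \<partial>(distr (M \<Otimes>\<^sub>M stream_space M) (stream_space M) (\<lambda>(x, \<omega>). x ## \<omega>)))"
    by (subst nn_integral_distr) auto
  also have "\<dots> = emeasure (distr (M \<Otimes>\<^sub>M stream_space M) (stream_space M) (\<lambda>(x, \<omega>). x ## \<omega>)) A"
    by simp
  finally show "emeasure (stream_space M) A =
    emeasure (distr (M \<Otimes>\<^sub>M stream_space M) (stream_space M) (\<lambda>(x, \<omega>). x ## \<omega>)) A" .
qed simp

text \<open>This plays the role of the Markov property: after the first noise is split off, the
  remaining stream has the same law. Writing the stream measure as a pushforward of a product
  reduces it to Fubini, integrability on the product included.\<close>

lemma (in prob_space) integral_stream_space: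
  fixes f :: "'a stream \<Rightarrow> 'b::{banach, second_countable_topology}"
  assumes f: "integrable (stream_space M) f"
  shows "(LINT \<omega>|stream_space M. f \<omega>) = (LINT x|M. LINT \<omega>|stream_space M. f (x ## \<omega>))"
proof -
  interpret S: prob_space "stream_space M" by (rule prob_space_stream_space)
  interpret P: pair_sigma_finite M "stream_space M" ..
  have m[measurable]: "f \<in> borel_measurable (stream_space M)" using f by auto
  have i: "integrable (M \<Otimes>\<^sub>M stream_space M) (\<lambda>z. f (case z of (x, \<omega>) \<Rightarrow> x ## \<omega>))"
    using f by (subst (asm) stream_space_eq_distr_pair, subst (asm) integrable_distr_eq) auto
  have "(LINT \<omega>|stream_space M. f \<omega>) =
      (LINT z|(M \<Otimes>\<^sub>M stream_space M). f (case z of (x, \<omega>) \<Rightarrow> x ## \<omega>))"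
    by (subst stream_space_eq_distr_pair, subst integral_distr) auto
  also have "\<dots> = (LINT x|M. LINT \<omega>|stream_space M. f (x ## \<omega>))"
    using P.integral_fst'[OF i] by simp
  finally show ?thesis .
qed

text \<open>\<open>\<Phi> \<eta> t\<close> is the position reached from \<open>\<eta>\<close> with
  noise \<open>t\<close>. Discs are present only through the mean value property, so everything
  proved here concerns bounded martingales in a Euclidean space.\<close>

locale disc_walk = prob_space U for U :: "real measure" +
  fixes \<Phi> :: "'a::euclidean_space \<Rightarrow> real \<Rightarrow> 'a" and V :: "'a set" and \<rho> :: real
  assumes sets_U[measurable_cong]: "sets U = sets borel"
    and measurable_Phi: "(\<lambda>(\<eta>, t). \<Phi> \<eta> t) \<in> borel_measurable (borel \<Otimes>\<^sub>M borel)"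
    and sets_V[measurable]: "V \<in> sets borel"
    and Phi_in: "\<eta> \<in> V \<Longrightarrow> \<Phi> \<eta> t \<in> V"
    and V_ball: "V \<subseteq> ball 0 \<rho>"
    and Phi_mean: "\<eta> \<in> V \<Longrightarrow> (LINT t|U. \<Phi> \<eta> t) = \<eta>"
begin

abbreviation S :: "real stream measure" where "S \<equiv> stream_space U"

sublocale S: prob_space S by (rule prob_space_stream_space)

text \<open>The recursion moves the starting point and consumes the head of the stream, so that
  inductions generalise over the start and use \<open>integral_stream_space\<close>.
  \<open>X_Suc\<close> gives the opposite reading, with the newest noise applied last.\<close>

primrec X :: "nat \<Rightarrow> 'a \<Rightarrow> real stream \<Rightarrow> 'a" where
  "X 0 \<eta> \<omega> = \<eta>"
| "X (Suc n) \<eta> \<omega> = X n (\<Phi> \<eta> (shd \<omega>)) (stl \<omega>)"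

lemma Phi_measurable[measurable (raw)]:
  assumes [measurable]: "f \<in> borel_measurable N" "g \<in> borel_measurable N"
  shows "(\<lambda>x. \<Phi> (f x) (g x)) \<in> borel_measurable N"
  using measurable_compose[OF _ measurable_Phi, of "\<lambda>x. (f x, g x)" N] by simp

lemma shd_measurable[measurable]: "shd \<in> borel_measurable S"
  using measurable_shd[of U] by (simp add: measurable_cong_sets[OF refl sets_U])

lemma X_measurable_pair: "(\<lambda>(\<eta>, \<omega>). X n \<eta> \<omega>) \<in> borel_measurable (borel \<Otimes>\<^sub>M S)"
proof (induction n)
  case (Suc n)
  have "(\<lambda>(\<eta>, \<omega>). X (Suc n) \<eta> \<omega>) = (\<lambda>(\<eta>, \<omega>). X n \<eta> \<omega>) \<circ> (\<lambda>(\<eta>, \<omega>). (\<Phi> \<eta> (shd \<omega>), stl \<omega>))"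
    by auto
  also have "\<dots> \<in> borel_measurable (borel \<Otimes>\<^sub>M S)"
    by (rule measurable_comp[OF _ Suc]) measurable
  finally show ?case .
qed simp

lemma X_measurable[measurable (raw)]:
  assumes [measurable]: "f \<in> borel_measurable N" "g \<in> measurable N S"
  shows "(\<lambda>x. X n (f x) (g x)) \<in> borel_measurable N"
  using measurable_compose[OF _ X_measurable_pair, of "\<lambda>x. (f x, g x)" N] by simp

lemma X_in: "\<eta> \<in> V \<Longrightarrow> X n \<eta> \<omega> \<in> V"
  by (induction n arbitrary: \<eta> \<omega>) (auto intro: Phi_in)

lemma norm_V_le: "\<eta> \<in> V \<Longrightarrow> norm \<eta> \<le> \<rho>"
  using V_ball by auto

lemma X_Suc: "X (Suc n) \<eta> \<omega> = \<Phi> (X n \<eta> \<omega>) (\<omega> !! n)"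
  by (induction n arbitrary: \<eta> \<omega>) auto

definition harmonic :: "('a \<Rightarrow> 'b::{banach, second_countable_topology}) \<Rightarrow> bool" where
  "harmonic h \<longleftrightarrow> h \<in> borel_measurable borel \<and> bounded (h ` V) \<and> (\<forall>\<eta>\<in>V. (LINT t|U. h (\<Phi> \<eta> t)) = h \<eta>)"

lemma integrable_X:
  fixes h :: "'a \<Rightarrow> 'b::{banach, second_countable_topology}"
  assumes [measurable]: "h \<in> borel_measurable borel" and "bounded (h ` V)" "\<eta> \<in> V"
  shows "integrable S (\<lambda>\<omega>. h (X n \<eta> \<omega>))"
proof -
  obtain B where "\<And>x. x \<in> V \<Longrightarrow> norm (h x) \<le> B" using assms(2) unfolding bounded_iff by auto
  then show ?thesis using X_in[OF assms(3)]
    by (intro S.integrable_const_bound[of _ B]) auto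
qed

lemma integrable_X_prod:
  fixes h :: "'a \<Rightarrow> 'b::{banach, second_countable_topology}" and G :: "'a \<Rightarrow> real"
  assumes [measurable]: "h \<in> borel_measurable borel" "G \<in> borel_measurable borel"
    and "bounded (h ` V)" "bounded (G ` V)" "\<eta> \<in> V"
  shows "integrable S (\<lambda>\<omega>. G (X n \<eta> \<omega>) *\<^sub>R h (X m \<eta> \<omega>))"
proof -
  obtain B C where "\<And>x. x \<in> V \<Longrightarrow> norm (h x) \<le> B" "\<And>x. x \<in> V \<Longrightarrow> \<bar>G x\<bar> \<le> C"
    using assms(3,4) unfolding bounded_iff by (auto simp: real_norm_def)
  then show ?thesis using X_in[OF assms(5)]
    by (intro S.integrable_const_bound[of _ "C * B"]) (auto intro!: AE_I2 mult_mono')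
qed

lemma harmonic_X:
  assumes h: "harmonic h" and \<eta>: "\<eta> \<in> V"
  shows "(LINT \<omega>|S. h (X m \<eta> \<omega>)) = h \<eta>"
  using \<eta>
proof (induction m arbitrary: \<eta>)
  case 0 then show ?case by (simp add: S.prob_space)
next
  case (Suc m)
  have "(LINT \<omega>|S. h (X (Suc m) \<eta> \<omega>)) = (LINT t|U. LINT \<omega>|S. h (X (Suc m) \<eta> (t ## \<omega>)))"
    using h Suc.prems by (intro integral_stream_space integrable_X) (auto simp: harmonic_def)
  also have "\<dots> = (LINT t|U. h (\<Phi> \<eta> t))" using Suc Phi_in by simp
  finally show ?case using h Suc.prems by (simp add: harmonic_def)
qed

text \<open>The martingale property, tested only against functions of the position at the earlier
  time; this replaces conditional expectation. Splitting off the first noise lowers both times by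
  one, and at \<open>n = 0\<close> the factor \<open>G\<close> is constant, so
  \<open>harmonic_X\<close> applies.\<close>

lemma harmonic_X_prod:
  fixes G :: "'a \<Rightarrow> real"
  assumes h: "harmonic h" and \<eta>: "\<eta> \<in> V" and G: "G \<in> borel_measurable borel" "bounded (G ` V)"
    and nm: "n \<le> m"
  shows "(LINT \<omega>|S. G (X n \<eta> \<omega>) *\<^sub>R h (X m \<eta> \<omega>)) = (LINT \<omega>|S. G (X n \<eta> \<omega>) *\<^sub>R h (X n \<eta> \<omega>))"
  using \<eta> nm
proof (induction n arbitrary: \<eta> m)
  case 0 then show ?case using harmonic_X[OF h] by (simp add: S.prob_space)
next
  case (Suc n)
  then obtain k where k: "m = Suc k" "n \<le> k" by (cases m) auto
  have hm: "h \<in> borel_measurable borel" "bounded (h ` V)" using h by (auto simp: harmonic_def)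
  have "(LINT \<omega>|S. G (X (Suc n) \<eta> \<omega>) *\<^sub>R h (X m \<eta> \<omega>)) =
    (LINT t|U. LINT \<omega>|S. G (X (Suc n) \<eta> (t ## \<omega>)) *\<^sub>R h (X m \<eta> (t ## \<omega>)))"
    by (intro integral_stream_space integrable_X_prod hm G Suc.prems)
  also have "\<dots> = (LINT t|U. LINT \<omega>|S. G (X (Suc n) \<eta> (t ## \<omega>)) *\<^sub>R h (X (Suc n) \<eta> (t ## \<omega>)))"
    using Suc.IH[OF Phi_in[OF Suc.prems(1)] k(2)] by (simp add: k)
  also have "\<dots> = (LINT \<omega>|S. G (X (Suc n) \<eta> \<omega>) *\<^sub>R h (X (Suc n) \<eta> \<omega>))"
    by (intro integral_stream_space[symmetric] integrable_X_prod hm G Suc.prems)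
  finally show ?case .
qed


section \<open>Orthogonal increments and convergence of the walk\<close>

lemma Phi_integrable: "\<eta> \<in> V \<Longrightarrow> integrable U (\<Phi> \<eta>)"
proof (rule integrable_const_bound[of _ \<rho>])
  show "\<Phi> \<eta> \<in> borel_measurable U"
    using Phi_measurable[of "\<lambda>_. \<eta>" U "\<lambda>t. t"] by (simp add: measurable_cong_sets[OF sets_U refl])
qed (auto intro!: AE_I2 norm_V_le Phi_in)

lemma bounded_inner_V: "bounded ((\<lambda>x. x \<bullet> b) ` V)"
  unfolding bounded_iff
proof (intro exI ballI)
  fix y assume "y \<in> (\<lambda>x. x \<bullet> b) ` V"
  then obtain x where "x \<in> V" "y = x \<bullet> b" by auto
  then show "norm y \<le> \<rho> * norm b"
    using Cauchy_Schwarz_ineq2[of x b] mult_right_mono[OF norm_V_le[of x], of "norm b"] by simp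
qed

lemma bounded_norm_sq_V: "bounded ((\<lambda>x. (norm x)\<^sup>2) ` V)"
  unfolding bounded_iff using norm_V_le by (intro exI[of _ "\<rho>\<^sup>2"]) (auto intro!: power_mono)

lemma harmonic_inner: "harmonic (\<lambda>x. x \<bullet> b)"
  unfolding harmonic_def using bounded_inner_V Phi_integrable Phi_mean by auto

text \<open>Each coordinate is bounded and harmonic, so \<open>harmonic_X_prod\<close> applies with
  the same coordinate as test function, and the results are summed over the basis.\<close>

lemma integral_inner_X:
  assumes "\<eta> \<in> V" "n \<le> m"
  shows "(LINT \<omega>|S. X n \<eta> \<omega> \<bullet> X m \<eta> \<omega>) = (LINT \<omega>|S. (norm (X n \<eta> \<omega>))\<^sup>2)"
proof -
  have i: "integrable S (\<lambda>\<omega>. (X n \<eta> \<omega> \<bullet> b) *\<^sub>R (X k \<eta> \<omega> \<bullet> b))" for b k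
    using bounded_inner_V assms(1)
    by (intro integrable_X_prod[of "\<lambda>x. x \<bullet> b" "\<lambda>x. x \<bullet> b"]) auto
  have "(LINT \<omega>|S. X n \<eta> \<omega> \<bullet> X m \<eta> \<omega>) = (\<Sum>b\<in>Basis. LINT \<omega>|S. (X n \<eta> \<omega> \<bullet> b) *\<^sub>R (X m \<eta> \<omega> \<bullet> b))"
    using i by (subst euclidean_inner) (auto intro!: Bochner_Integration.integral_sum)
  also have "\<dots> = (\<Sum>b\<in>Basis. LINT \<omega>|S. (X n \<eta> \<omega> \<bullet> b) *\<^sub>R (X n \<eta> \<omega> \<bullet> b))"
    using bounded_inner_V assms by (intro sum.cong refl harmonic_X_prod harmonic_inner) auto
  also have "\<dots> = (LINT \<omega>|S. X n \<eta> \<omega> \<bullet> X n \<eta> \<omega>)"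
    using i by (subst euclidean_inner) (auto intro!: Bochner_Integration.integral_sum[symmetric])
  finally show ?thesis by (simp add: power2_norm_eq_inner)
qed

lemma integrable_norm_X: "\<eta> \<in> V \<Longrightarrow> integrable S (\<lambda>\<omega>. (norm (X n \<eta> \<omega>))\<^sup>2)"
  using integrable_X[of "\<lambda>x. (norm x)\<^sup>2"] bounded_norm_sq_V by auto

lemma norm_X_diff_le: "\<eta> \<in> V \<Longrightarrow> norm (X m \<eta> \<omega> - X n \<eta> \<omega>) \<le> 2 * \<rho>"
  using norm_triangle_ineq4[of "X m \<eta> \<omega>" "X n \<eta> \<omega>"] norm_V_le[OF X_in[of \<eta> m \<omega>]] norm_V_le[OF X_in[of \<eta> n \<omega>]]
  by linarith

lemma integrable_norm_X_diff: "\<eta> \<in> V \<Longrightarrow> integrable S (\<lambda>\<omega>. norm (X m \<eta> \<omega> - X n \<eta> \<omega>) ^ k)"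
proof (rule S.integrable_const_bound[of _ "(2 * \<rho>) ^ k"])
  assume \<eta>: "\<eta> \<in> V"
  show "AE \<omega> in S. norm (norm (X m \<eta> \<omega> - X n \<eta> \<omega>) ^ k) \<le> (2 * \<rho>) ^ k"
    using power_mono[OF norm_X_diff_le[OF \<eta>] norm_ge_zero] by (intro AE_I2) (simp only: real_norm_def power_abs abs_norm_cancel)
qed measurable

text \<open>Pythagoras: by \<open>integral_inner_X\<close> the increment is orthogonal to
  \<open>X n\<close>.\<close>

lemma integral_norm_X_diff_sq:
  assumes \<eta>: "\<eta> \<in> V" and "n \<le> m"
  shows "(LINT \<omega>|S. (norm (X m \<eta> \<omega> - X n \<eta> \<omega>))\<^sup>2) =
    (LINT \<omega>|S. (norm (X m \<eta> \<omega>))\<^sup>2) - (LINT \<omega>|S. (norm (X n \<eta> \<omega>))\<^sup>2)"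
proof -
  have i: "integrable S (\<lambda>\<omega>. X n \<eta> \<omega> \<bullet> X m \<eta> \<omega>)"
    using \<eta> bounded_inner_V by (subst euclidean_inner)
      (auto intro!: Bochner_Integration.integrable_sum integrable_X_prod[of "\<lambda>x. x \<bullet> _" "\<lambda>x. x \<bullet> _", unfolded real_scaleR_def])
  have "(LINT \<omega>|S. (norm (X m \<eta> \<omega> - X n \<eta> \<omega>))\<^sup>2) =
    (LINT \<omega>|S. (norm (X m \<eta> \<omega>))\<^sup>2 + (norm (X n \<eta> \<omega>))\<^sup>2 - 2 * (X n \<eta> \<omega> \<bullet> X m \<eta> \<omega>))"
    by (simp add: power2_norm_eq_inner inner_diff inner_commute algebra_simps)
  also have "\<dots> = (LINT \<omega>|S. (norm (X m \<eta> \<omega>))\<^sup>2) + (LINT \<omega>|S. (norm (X n \<eta> \<omega>))\<^sup>2)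
      - 2 * (LINT \<omega>|S. X n \<eta> \<omega> \<bullet> X m \<eta> \<omega>)"
    using i integrable_norm_X[OF \<eta>] by simp
  finally show ?thesis using integral_inner_X[OF assms] by simp
qed

definition energy :: "'a \<Rightarrow> nat \<Rightarrow> real" where "energy \<eta> n = (LINT \<omega>|S. (norm (X n \<eta> \<omega>))\<^sup>2)"

lemma energy_mono: "\<eta> \<in> V \<Longrightarrow> n \<le> m \<Longrightarrow> energy \<eta> n \<le> energy \<eta> m"
  using integral_norm_X_diff_sq[of \<eta> n m] Bochner_Integration.integral_nonneg[of S "\<lambda>\<omega>. (norm (X m \<eta> \<omega> - X n \<eta> \<omega>))\<^sup>2"]
  unfolding energy_def by auto

lemma energy_le: "\<eta> \<in> V \<Longrightarrow> energy \<eta> n \<le> \<rho>\<^sup>2"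
proof -
  assume \<eta>: "\<eta> \<in> V"
  have "energy \<eta> n \<le> (LINT \<omega>|S. \<rho>\<^sup>2)" unfolding energy_def
    using \<eta> norm_V_le X_in by (intro integral_mono integrable_norm_X) (auto intro!: power_mono)
  then show ?thesis by (simp add: S.prob_space)
qed

text \<open>The energy increases and is bounded by \<open>\<rho>\<^sup>2\<close>, hence is Cauchy,
  and its differences are squared distances in the mean. Passing to a subsequence replaces the
  martingale convergence theorem.\<close>

lemma X_Cauchy_subseq:
  assumes \<eta>: "\<eta> \<in> V"
  obtains r where "strict_mono r" "AE \<omega> in S. Cauchy (\<lambda>i. X (r i) \<eta> \<omega>)"
proof (rule cauchy_L1_AE_cauchy_subseq[of S "\<lambda>n. X n \<eta>"])
  show "integrable S (X n \<eta>)" for n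
    using integrable_X[of "\<lambda>x. x"] \<eta> norm_V_le by (auto simp: bounded_iff)
  fix e :: real assume e: "e > 0"
  have "convergent (energy \<eta>)"
    using energy_mono[OF \<eta>] energy_le[OF \<eta>] by (intro Bseq_mono_convergent BseqI'[of _ "\<rho>\<^sup>2"])
      (auto simp: energy_def)
  then have "Cauchy (energy \<eta>)" by (simp add: Cauchy_convergent_iff)
  then obtain N where N: "\<And>m n. m \<ge> N \<Longrightarrow> n \<ge> N \<Longrightarrow> \<bar>energy \<eta> m - energy \<eta> n\<bar> < e^2/4"
    using e by (metis CauchyD real_norm_def divide_pos_pos zero_less_numeral zero_less_power)
  have *: "(LINT \<omega>|S. norm (X m \<eta> \<omega> - X n \<eta> \<omega>)) < e" if "n \<le> m" "n \<ge> N" "m \<ge> N" for m n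
  proof -
    \<comment> \<open>The elementary bound \<open>u \<le> e/2 + u\<^sup>2/e\<close> passes from
      second to first moments; with an energy difference below \<open>e\<^sup>2/4\<close> the total
      stays below \<open>3*e/4\<close>.\<close>
    have "(LINT \<omega>|S. norm (X m \<eta> \<omega> - X n \<eta> \<omega>)) \<le> (LINT \<omega>|S. e/2 + (norm (X m \<eta> \<omega> - X n \<eta> \<omega>))\<^sup>2 / e)"
    proof (rule integral_mono)
      fix \<omega>
      have "e * (norm (X m \<eta> \<omega> - X n \<eta> \<omega>)) \<le> e\<^sup>2/2 + (norm (X m \<eta> \<omega> - X n \<eta> \<omega>))\<^sup>2"
        using sum_squares_bound[of "e" "norm (X m \<eta> \<omega> - X n \<eta> \<omega>)"]
          zero_le_power2[of "norm (X m \<eta> \<omega> - X n \<eta> \<omega>)"] zero_le_power2[of e] by linarith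
      then show "norm (X m \<eta> \<omega> - X n \<eta> \<omega>) \<le> e/2 + (norm (X m \<eta> \<omega> - X n \<eta> \<omega>))\<^sup>2 / e"
        using e by (simp add: field_simps power2_eq_square)
    qed (use integrable_norm_X_diff[OF \<eta>, of m n 1] integrable_norm_X_diff[OF \<eta>, of m n 2] in auto)
    also have "\<dots> = e/2 + (energy \<eta> m - energy \<eta> n) / e"
      using integrable_norm_X_diff[OF \<eta>, of m n 2] integral_norm_X_diff_sq[OF \<eta> that(1)] by (simp add: S.prob_space energy_def)
    also have "\<dots> < e"
    proof -
      have "energy \<eta> m - energy \<eta> n < e/4 * e"
        using le_less_trans[OF abs_ge_self N[OF that(3,2)]] by (simp add: power2_eq_square)
      then have "(energy \<eta> m - energy \<eta> n) / e < e/4" by (simp only: pos_divide_less_eq[OF e])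
      then show ?thesis using e by linarith
    qed
    finally show ?thesis .
  qed
  show "\<exists>N. \<forall>i\<ge>N. \<forall>j\<ge>N. (LINT x|S. norm (X i \<eta> x - X j \<eta> x)) < e"
  proof (intro exI[of _ N] allI impI)
    fix i j assume "i \<ge> N" "j \<ge> N"
    then show "(LINT x|S. norm (X i \<eta> x - X j \<eta> x)) < e"
      using *[of j i] *[of i j] by (cases "j \<le> i") (simp_all add: norm_minus_commute[of "X i \<eta> _"])
  qed
qed (use that in blast)

text \<open>The expected squared steps telescope to an energy difference of at most
  \<open>\<rho>\<^sup>2\<close>, so the squared steps are almost surely summable. This concerns the
  full sequence; convergence along a subsequence would say nothing about the step that follows a
  selected time.\<close>

lemma X_steps_tendsto_0:
  assumes \<eta>: "\<eta> \<in> V"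
  shows "AE \<omega> in S. (\<lambda>n. X (Suc n) \<eta> \<omega> - X n \<eta> \<omega>) \<longlonglongrightarrow> 0"
proof -
  let ?f = "\<lambda>n \<omega>. (norm (X (Suc n) \<eta> \<omega> - X n \<eta> \<omega>))\<^sup>2"
  have [measurable]: "X n \<eta> \<in> borel_measurable S" for n by measurable
  have fin: "(\<integral>\<^sup>+\<omega>. (\<Sum>n. ennreal (?f n \<omega>)) \<partial>S) \<le> ennreal (\<rho>\<^sup>2)"
  proof -
    have "(\<integral>\<^sup>+\<omega>. (\<Sum>n. ennreal (?f n \<omega>)) \<partial>S) = (\<Sum>n. \<integral>\<^sup>+\<omega>. ennreal (?f n \<omega>) \<partial>S)"
      by (rule nn_integral_suminf) measurable
    also have "\<dots> = (\<Sum>n. ennreal (energy \<eta> (Suc n) - energy \<eta> n))"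
      using integrable_norm_X_diff[OF \<eta>, of _ _ 2] integral_norm_X_diff_sq[OF \<eta>, of _ "Suc _"]
      by (intro suminf_cong, subst nn_integral_eq_integral) (auto simp: energy_def simp del: X.simps)
    also have "\<dots> \<le> ennreal (\<rho>\<^sup>2)"
    proof (rule suminf_le_const[OF summableI])
      fix n
      have "(\<Sum>i<n. ennreal (energy \<eta> (Suc i) - energy \<eta> i)) = ennreal (\<Sum>i<n. energy \<eta> (Suc i) - energy \<eta> i)"
        using energy_mono[OF \<eta>] by (intro sum_ennreal) auto
      also have "\<dots> = ennreal (energy \<eta> n - energy \<eta> 0)" by (subst sum_lessThan_telescope) simp
      also have "\<dots> \<le> ennreal (\<rho>\<^sup>2)"
      proof (rule ennreal_leI)
        have "0 \<le> energy \<eta> 0" unfolding energy_def by simp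
        then show "energy \<eta> n - energy \<eta> 0 \<le> \<rho>\<^sup>2" using energy_le[OF \<eta>, of n] by linarith
      qed
      finally show "(\<Sum>i<n. ennreal (energy \<eta> (Suc i) - energy \<eta> i)) \<le> ennreal (\<rho>\<^sup>2)" .
    qed
    finally show ?thesis .
  qed
  have "AE \<omega> in S. (\<Sum>n. ennreal (?f n \<omega>)) \<noteq> \<infinity>"
    using fin by (intro nn_integral_PInf_AE) (auto simp: top_unique)
  then show ?thesis
  proof eventually_elim
    case (elim \<omega>)
    then have "summable (\<lambda>n. ?f n \<omega>)"
      by (intro summable_suminf_not_top) auto
    then have "(\<lambda>n. ?f n \<omega>) \<longlonglongrightarrow> 0" by (rule summable_LIMSEQ_zero)
    then have "(\<lambda>n. sqrt (?f n \<omega>)) \<longlonglongrightarrow> sqrt 0" by (rule tendsto_real_sqrt)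
    then show ?case by (simp add: tendsto_norm_zero_iff)
  qed
qed

end

text \<open>\<open>\<kappa>\<close> is a barrier with the mean value property. Its lower bound is
  also required one step ahead, because the step that leaves the ball of radius \<open>R\<close>
  still enters the mean. In \<open>dichotomy\<close>, a point with a neighbourhood disjoint from
  \<open>V\<close> satisfies the second alternative vacuously.\<close>

locale exit_walk = disc_walk +
  fixes \<kappa> :: "'a \<Rightarrow> real"
  assumes measurable_kappa[measurable]: "\<kappa> \<in> borel_measurable borel"
    and kappa_lower: "R < \<rho> \<Longrightarrow>
      \<exists>M. \<forall>\<eta>\<in>V. norm \<eta> \<le> R \<longrightarrow> - M \<le> \<kappa> \<eta> \<and> (\<forall>t. - M \<le> \<kappa> (\<Phi> \<eta> t))"
    and kappa_integrable: "\<eta> \<in> V \<Longrightarrow> integrable U (\<lambda>t. \<kappa> (\<Phi> \<eta> t))"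
    and kappa_mean: "\<eta> \<in> V \<Longrightarrow> (LINT t|U. \<kappa> (\<Phi> \<eta> t)) = \<kappa> \<eta>"
    and dichotomy: "norm p < \<rho> \<Longrightarrow>
      (\<exists>\<delta>>0. \<exists>N. open N \<and> p \<in> N \<and> (\<forall>\<eta>\<in>N \<inter> V. \<forall>t. \<delta> \<le> norm (\<Phi> \<eta> t - \<eta>))) \<or>
      (\<forall>L. \<exists>N. open N \<and> p \<in> N \<and> (\<forall>\<eta>\<in>N \<inter> V. L \<le> \<kappa> \<eta>))"
begin

section \<open>Stopped estimates: the walk cannot settle inside the ball\<close>

definition exceeds :: "nat \<Rightarrow> real \<Rightarrow> 'a \<Rightarrow> real stream \<Rightarrow> bool" where
  "exceeds n R \<eta> \<omega> \<longleftrightarrow> (\<exists>j\<le>n. R \<le> norm (X j \<eta> \<omega>))"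

lemma exceeds_Suc: "exceeds (Suc n) R \<eta> \<omega> \<longleftrightarrow> R \<le> norm \<eta> \<or> exceeds n R (\<Phi> \<eta> (shd \<omega>)) (stl \<omega>)"
proof -
  have "(\<exists>j\<le>Suc n. P j) \<longleftrightarrow> P 0 \<or> (\<exists>j\<le>n. P (Suc j))" for P
    by (metis Suc_le_mono le0 not0_implies_Suc)
  then show ?thesis unfolding exceeds_def by auto
qed

lemma exceeds_measurable[measurable (raw)]:
  assumes [measurable]: "f \<in> borel_measurable N" "g \<in> measurable N S"
  shows "Measurable.pred N (\<lambda>x. exceeds n R (f x) (g x))"
  unfolding exceeds_def by measurable

lemma nn_integral_defect_le:
  assumes \<eta>: "\<eta> \<in> V"
  shows "(\<integral>\<^sup>+\<omega>. ennreal (\<rho>\<^sup>2 - (norm (X n \<eta> \<omega>))\<^sup>2) \<partial>S) \<le> ennreal (\<rho>\<^sup>2 - (norm \<eta>)\<^sup>2)"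
proof -
  have "(\<integral>\<^sup>+\<omega>. ennreal (\<rho>\<^sup>2 - (norm (X n \<eta> \<omega>))\<^sup>2) \<partial>S) = ennreal (LINT \<omega>|S. \<rho>\<^sup>2 - (norm (X n \<eta> \<omega>))\<^sup>2)"
    using integrable_norm_X[OF \<eta>] norm_V_le X_in[OF \<eta>]
    by (intro nn_integral_eq_integral) (auto intro!: AE_I2 power_mono)
  also have "\<dots> = ennreal (\<rho>\<^sup>2 - energy \<eta> n)"
    using integrable_norm_X[OF \<eta>] by (simp add: energy_def S.prob_space)
  also have "\<dots> \<le> ennreal (\<rho>\<^sup>2 - energy \<eta> 0)" using energy_mono[OF \<eta>, of 0 n] by (auto intro: ennreal_leI)
  finally show ?thesis by (simp add: energy_def S.prob_space)
qed

text \<open>Optional stopping by induction on \<open>n\<close>. A start outside radius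
  \<open>R\<close> has defect at most \<open>\<rho>\<^sup>2 - R\<^sup>2\<close>, and the defect does
  not grow in the mean. From a start inside, the event is decided by the walk after the first step,
  and the induction bound does not depend on where that step ends.\<close>

lemma nn_integral_exceeds_le:
  assumes \<eta>: "\<eta> \<in> V" and R: "0 \<le> R"
  shows "(\<integral>\<^sup>+\<omega>. (if exceeds n R \<eta> \<omega> then ennreal (\<rho>\<^sup>2 - (norm (X n \<eta> \<omega>))\<^sup>2) else 0) \<partial>S) \<le> ennreal (\<rho>\<^sup>2 - R\<^sup>2)"
  using \<eta>
proof (induction n arbitrary: \<eta>)
  case (0 \<eta>)
  have "(if exceeds 0 R \<eta> \<omega> then ennreal (\<rho>\<^sup>2 - (norm (X 0 \<eta> \<omega>))\<^sup>2) else 0) \<le> ennreal (\<rho>\<^sup>2 - R\<^sup>2)" for \<omega>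
    using R by (auto simp: exceeds_def intro!: ennreal_leI power_mono)
  then have "(\<integral>\<^sup>+\<omega>. (if exceeds 0 R \<eta> \<omega> then ennreal (\<rho>\<^sup>2 - (norm (X 0 \<eta> \<omega>))\<^sup>2) else 0) \<partial>S) \<le> (\<integral>\<^sup>+\<omega>. ennreal (\<rho>\<^sup>2 - R\<^sup>2) \<partial>S)"
    by (intro nn_integral_mono)
  then show ?case by (simp add: S.emeasure_space_1)
next
  case (Suc n)
  show ?case
  proof (cases "R \<le> norm \<eta>")
    case True
    have "(\<integral>\<^sup>+\<omega>. (if exceeds (Suc n) R \<eta> \<omega> then ennreal (\<rho>\<^sup>2 - (norm (X (Suc n) \<eta> \<omega>))\<^sup>2) else 0) \<partial>S)
      \<le> (\<integral>\<^sup>+\<omega>. ennreal (\<rho>\<^sup>2 - (norm (X (Suc n) \<eta> \<omega>))\<^sup>2) \<partial>S)"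
      by (intro nn_integral_mono) auto
    also have "\<dots> \<le> ennreal (\<rho>\<^sup>2 - (norm \<eta>)\<^sup>2)" by (rule nn_integral_defect_le[OF Suc.prems])
    also have "\<dots> \<le> ennreal (\<rho>\<^sup>2 - R\<^sup>2)" using True R by (auto intro!: ennreal_leI power_mono)
    finally show ?thesis .
  next
    case False
    have "(\<integral>\<^sup>+\<omega>. (if exceeds (Suc n) R \<eta> \<omega> then ennreal (\<rho>\<^sup>2 - (norm (X (Suc n) \<eta> \<omega>))\<^sup>2) else 0) \<partial>S)
      = (\<integral>\<^sup>+t. (\<integral>\<^sup>+\<omega>. (if exceeds (Suc n) R \<eta> (t ## \<omega>) then ennreal (\<rho>\<^sup>2 - (norm (X (Suc n) \<eta> (t ## \<omega>)))\<^sup>2) else 0) \<partial>S) \<partial>U)"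
      by (rule nn_integral_stream_space) measurable
    also have "\<dots> \<le> (\<integral>\<^sup>+t. ennreal (\<rho>\<^sup>2 - R\<^sup>2) \<partial>U)"
      using Suc.IH[OF Phi_in[OF Suc.prems]] False by (intro nn_integral_mono) (simp add: exceeds_Suc cong: if_cong)
    finally show ?thesis by (simp add: emeasure_space_1)
  qed
qed

text \<open>The value is replaced by 0 once the walk has left radius \<open>R\<close>. Up to and
  including the step out, \<open>\<kappa> + M\<close> is nonnegative with constant mean, so the
  replacement can only lower the integral.\<close>

lemma nn_integral_kappa_le:
  assumes M: "\<And>\<eta> t. \<eta> \<in> V \<Longrightarrow> norm \<eta> \<le> R \<Longrightarrow> - M \<le> \<kappa> (\<Phi> \<eta> t)"
    and \<eta>: "\<eta> \<in> V" "- M \<le> \<kappa> \<eta>"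
  shows "(\<integral>\<^sup>+\<omega>. (if exceeds n R \<eta> \<omega> then 0 else ennreal (\<kappa> (X n \<eta> \<omega>) + M)) \<partial>S) \<le> ennreal (\<kappa> \<eta> + M)"
  using \<eta>
proof (induction n arbitrary: \<eta>)
  case (0 \<eta>)
  have "(\<integral>\<^sup>+\<omega>. (if exceeds 0 R \<eta> \<omega> then 0 else ennreal (\<kappa> (X 0 \<eta> \<omega>) + M)) \<partial>S) \<le> (\<integral>\<^sup>+\<omega>. ennreal (\<kappa> \<eta> + M) \<partial>S)"
    by (intro nn_integral_mono) auto
  then show ?case by (simp add: S.emeasure_space_1)
next
  case (Suc n)
  show ?case
  proof (cases "R \<le> norm \<eta>")
    case True
    then show ?thesis by (simp add: exceeds_Suc)
  next
    case False
    then have M': "- M \<le> \<kappa> (\<Phi> \<eta> t)" for t using M Suc.prems by simp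
    have "(\<integral>\<^sup>+\<omega>. (if exceeds (Suc n) R \<eta> \<omega> then 0 else ennreal (\<kappa> (X (Suc n) \<eta> \<omega>) + M)) \<partial>S)
      = (\<integral>\<^sup>+t. (\<integral>\<^sup>+\<omega>. (if exceeds (Suc n) R \<eta> (t ## \<omega>) then 0 else ennreal (\<kappa> (X (Suc n) \<eta> (t ## \<omega>)) + M)) \<partial>S) \<partial>U)"
      by (rule nn_integral_stream_space) measurable
    also have "\<dots> \<le> (\<integral>\<^sup>+t. ennreal (\<kappa> (\<Phi> \<eta> t) + M) \<partial>U)"
      using Suc.IH[OF Phi_in[OF Suc.prems(1)] M'] False by (intro nn_integral_mono) (simp add: exceeds_Suc cong: if_cong)
    also have "\<dots> = ennreal (LINT t|U. \<kappa> (\<Phi> \<eta> t) + M)"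
      using kappa_integrable[OF Suc.prems(1)] M'
      by (intro nn_integral_eq_integral) (auto intro!: AE_I2 simp: real_0_le_add_iff add.commute[of _ M])
    also have "\<dots> = ennreal (\<kappa> \<eta> + M)"
      using kappa_integrable[OF Suc.prems(1)] kappa_mean[OF Suc.prems(1)] by (simp add: prob_space)
    finally show ?thesis .
  qed
qed

text \<open>
  Stop the walk on leaving the ball of radius \<open>R\<close>. If it leaves, it is unlikely to come back
  inside \<open>R0\<close>, since \<open>\<rho>\<^sup>2 - \<bar>X\<^sub>n\<bar>\<^sup>2\<close> is a nonnegative supermartingale; if it does not leave, \<open>\<kappa> + M\<close> is a
  nonnegative martingale, and Markov's inequality applies.
\<close>
lemma interior_blowup_small:
  assumes \<eta>: "\<eta> \<in> V" and R0: "0 \<le> R0" "R0 < \<rho>" and e: "e > 0"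
  obtains L where "\<And>n. emeasure S {\<omega>\<in>space S. norm (X n \<eta> \<omega>) < R0 \<and> L \<le> \<kappa> (X n \<eta> \<omega>)} \<le> ennreal e"
proof -
  \<comment> \<open>Inside radius \<open>R0\<close> the defect is at least \<open>c\<close>.
    Choosing \<open>R\<close> with \<open>\<rho>\<^sup>2 - R\<^sup>2 < c * (e/2)\<close> makes the
    probability of being back inside after an exit at most \<open>e/2\<close>.\<close>
  define c where "c = \<rho>\<^sup>2 - R0\<^sup>2"
  have c: "c > 0" using R0 by (auto simp: c_def intro!: power_strict_mono)
  have "\<exists>R. 0 \<le> R \<and> norm \<eta> < R \<and> R < \<rho> \<and> \<rho>\<^sup>2 - R\<^sup>2 < c * (e/2)"
  proof -
    have "((\<lambda>R. \<rho>\<^sup>2 - R\<^sup>2) \<longlongrightarrow> \<rho>\<^sup>2 - \<rho>\<^sup>2) (at_left \<rho>)" by (intro tendsto_intros)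
    then have "eventually (\<lambda>R. \<rho>\<^sup>2 - R\<^sup>2 < c * (e/2)) (at_left \<rho>)"
      using c e by (intro order_tendstoD(2)) auto
    moreover have "eventually (\<lambda>R. R < \<rho>) (at_left \<rho>)" by (simp add: eventually_at_filter)
    moreover have "eventually (\<lambda>R. max 0 (norm \<eta>) < R) (at_left \<rho>)"
      using R0 V_ball \<eta> by (intro eventually_at_leftI[of "max 0 (norm \<eta>)"]) auto
    ultimately have "eventually (\<lambda>R. 0 \<le> R \<and> norm \<eta> < R \<and> R < \<rho> \<and> \<rho>\<^sup>2 - R\<^sup>2 < c * (e/2)) (at_left \<rho>)"
      by eventually_elim (auto intro: order.trans[OF norm_ge_zero less_imp_le])
    then show ?thesis using eventually_happens trivial_limit_at_left_real by blast
  qed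
  then obtain R where R: "0 \<le> R" "norm \<eta> < R" "R < \<rho>" "\<rho>\<^sup>2 - R\<^sup>2 < c * (e/2)" by blast
  obtain M where M: "\<And>\<eta>. \<eta> \<in> V \<Longrightarrow> norm \<eta> \<le> R \<Longrightarrow> - M \<le> \<kappa> \<eta>"
     "\<And>\<eta> t. \<eta> \<in> V \<Longrightarrow> norm \<eta> \<le> R \<Longrightarrow> - M \<le> \<kappa> (\<Phi> \<eta> t)"
    using kappa_lower[OF R(3)] by auto
  have \<kappa>: "- M \<le> \<kappa> \<eta>" using M(1)[OF \<eta>] R by simp
  \<comment> \<open>Adding 1 keeps \<open>K\<close> positive. Since \<open>L + M = 2*K/e\<close>,
    Markov's inequality bounds the other half of the event by
    \<open>(\<kappa> \<eta> + M) / (L + M) \<le> e/2\<close>.\<close>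
  define K where "K = \<kappa> \<eta> + M + 1"
  have K: "K > 0" using \<kappa> by (simp add: K_def)
  define L where "L = 2 * K / e - M"
  have "emeasure S {\<omega>\<in>space S. norm (X n \<eta> \<omega>) < R0 \<and> L \<le> \<kappa> (X n \<eta> \<omega>)} \<le> ennreal e" for n
  proof -
    let ?f = "\<lambda>\<omega>. (if exceeds n R \<eta> \<omega> then ennreal (\<rho>\<^sup>2 - (norm (X n \<eta> \<omega>))\<^sup>2) else 0)"
    let ?g = "\<lambda>\<omega>. (if exceeds n R \<eta> \<omega> then 0 else ennreal (\<kappa> (X n \<eta> \<omega>) + M))"
    let ?A = "{\<omega>\<in>space S. norm (X n \<eta> \<omega>) < R0 \<and> L \<le> \<kappa> (X n \<eta> \<omega>)}"
    have [measurable]: "?f \<in> borel_measurable S" "?g \<in> borel_measurable S" by measurable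
    \<comment> \<open>Both Markov inequalities in pointwise form; exactly one summand is
      responsible, according to whether the walk has left radius \<open>R\<close>.\<close>
    have pt: "indicator ?A \<omega> \<le> ennreal (1/c) * ?f \<omega> + ennreal (e/(2*K)) * ?g \<omega>" for \<omega>
    proof (cases "\<omega> \<in> ?A")
      case True
      then have 1: "norm (X n \<eta> \<omega>) < R0" and 2: "L \<le> \<kappa> (X n \<eta> \<omega>)" by auto
      show ?thesis
      proof (cases "exceeds n R \<eta> \<omega>")
        case True
        have "(norm (X n \<eta> \<omega>))\<^sup>2 \<le> R0\<^sup>2" using 1 by (intro power_mono) auto
        then have "c \<le> \<rho>\<^sup>2 - (norm (X n \<eta> \<omega>))\<^sup>2" by (simp add: c_def)
        then have "1 \<le> 1/c * (\<rho>\<^sup>2 - (norm (X n \<eta> \<omega>))\<^sup>2)" using c by (simp add: field_simps)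
        then have "1 \<le> ennreal (1/c) * ennreal (\<rho>\<^sup>2 - (norm (X n \<eta> \<omega>))\<^sup>2)"
          using c by (subst ennreal_mult'[symmetric]) (auto simp del: times_divide_eq_left)
        then show ?thesis using True \<open>\<omega> \<in> ?A\<close> by simp
      next
        case False
        have "2*K/e \<le> \<kappa> (X n \<eta> \<omega>) + M" using 2 by (simp add: L_def)
        then have "1 \<le> e/(2*K) * (\<kappa> (X n \<eta> \<omega>) + M)" using K e by (simp add: field_simps)
        then have "1 \<le> ennreal (e/(2*K)) * ennreal (\<kappa> (X n \<eta> \<omega>) + M)"
          using K e by (subst ennreal_mult'[symmetric]) (auto simp del: times_divide_eq_left)
        then show ?thesis using False \<open>\<omega> \<in> ?A\<close> by simp
      qed
    qed auto
    have "emeasure S ?A = (\<integral>\<^sup>+\<omega>. indicator ?A \<omega> \<partial>S)" by (intro nn_integral_indicator[symmetric]) measurable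
    also have "\<dots> \<le> (\<integral>\<^sup>+\<omega>. ennreal (1/c) * ?f \<omega> + ennreal (e/(2*K)) * ?g \<omega> \<partial>S)"
      by (intro nn_integral_mono pt)
    also have "\<dots> = ennreal (1/c) * (\<integral>\<^sup>+\<omega>. ?f \<omega> \<partial>S) + ennreal (e/(2*K)) * (\<integral>\<^sup>+\<omega>. ?g \<omega> \<partial>S)"
      by (simp add: nn_integral_add nn_integral_cmult)
    also have "\<dots> \<le> ennreal (1/c) * ennreal (\<rho>\<^sup>2 - R\<^sup>2) + ennreal (e/(2*K)) * ennreal (\<kappa> \<eta> + M)"
      by (intro add_mono mult_left_mono nn_integral_exceeds_le nn_integral_kappa_le \<eta> R(1) M(2) \<kappa>) auto
    also have "\<dots> = ennreal (1/c * (\<rho>\<^sup>2 - R\<^sup>2) + e/(2*K) * (\<kappa> \<eta> + M))"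
    proof -
      have "0 \<le> \<rho>\<^sup>2 - R\<^sup>2" "0 \<le> \<kappa> \<eta> + M" using \<kappa> R by (auto intro: power_mono)
      then show ?thesis using c e K by (subst ennreal_plus) (auto simp: ennreal_mult simp del: times_divide_eq_left)
    qed
    also have "\<dots> \<le> ennreal e"
    proof (rule ennreal_leI)
      have "1/c * (\<rho>\<^sup>2 - R\<^sup>2) \<le> e/2" using R(4) c by (simp add: field_simps)
      moreover have "e/(2*K) * (\<kappa> \<eta> + M) \<le> e/(2*K) * K" using e K by (intro mult_left_mono) (auto simp: K_def)
      moreover have "e/(2*K) * K = e/2" using K by simp
      ultimately show "1/c * (\<rho>\<^sup>2 - R\<^sup>2) + e/(2*K) * (\<kappa> \<eta> + M) \<le> e" by linarith
    qed
    finally show ?thesis .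
  qed
  then show thesis by (rule that)
qed

text \<open>The bound of \<open>interior_blowup_small\<close> is uniform in time, so it survives the
  passage to the event that almost all selected times are bad. A blow-up belongs to this event at
  every level \<open>L k\<close>, where the probability is at most \<open>1 / Suc k\<close>.\<close>

lemma no_interior_blowup:
  assumes \<eta>: "\<eta> \<in> V" and R0: "0 \<le> R0" "R0 < \<rho>"
  shows "AE \<omega> in S. \<not> ((\<forall>\<^sub>F n in sequentially. norm (X (r n) \<eta> \<omega>) < R0) \<and>
    filterlim (\<lambda>n. \<kappa> (X (r n) \<eta> \<omega>)) at_top sequentially)"
proof -
  have "\<exists>L. \<forall>n. emeasure S {\<omega>\<in>space S. norm (X n \<eta> \<omega>) < R0 \<and> L \<le> \<kappa> (X n \<eta> \<omega>)} \<le> ennreal (1 / Suc k)" for k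
  proof -
    have "0 < 1 / real (Suc k)" by simp
    then show ?thesis by (rule interior_blowup_small[OF \<eta> R0]) blast
  qed
  then have "\<forall>k. \<exists>L. \<forall>n. emeasure S {\<omega>\<in>space S. norm (X n \<eta> \<omega>) < R0 \<and> L \<le> \<kappa> (X n \<eta> \<omega>)} \<le> ennreal (1 / Suc k)"
    by (rule allI)
  from choice[OF this] obtain L where
    L: "\<And>k n. emeasure S {\<omega>\<in>space S. norm (X n \<eta> \<omega>) < R0 \<and> L k \<le> \<kappa> (X n \<eta> \<omega>)} \<le> ennreal (1 / Suc k)"
    by (elim exE) (rule that, drule spec, drule spec, assumption)
  define A where "A k n = {\<omega>\<in>space S. norm (X (r n) \<eta> \<omega>) < R0 \<and> L k \<le> \<kappa> (X (r n) \<eta> \<omega>)}" for k n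
  define Q where "Q k = (\<Union>N. \<Inter>n\<in>{N..}. A k n)" for k
  have A[measurable]: "A k n \<in> sets S" for k n unfolding A_def by measurable
  have Qm[measurable]: "Q k \<in> sets S" for k unfolding Q_def by measurable
  have Q: "emeasure S (Q k) \<le> ennreal (1 / Suc k)" for k
  proof -
    have "emeasure S (Q k) = (SUP N. emeasure S (\<Inter>n\<in>{N..}. A k n))"
      unfolding Q_def by (subst SUP_emeasure_incseq) (auto simp: incseq_def)
    also have "\<dots> \<le> ennreal (1 / Suc k)"
    proof (rule SUP_least)
      fix N
      have "emeasure S (\<Inter>n\<in>{N..}. A k n) \<le> emeasure S (A k N)" by (intro emeasure_mono) auto
      also have "\<dots> \<le> ennreal (1 / Suc k)" unfolding A_def by (rule L)
      finally show "emeasure S (\<Inter>n\<in>{N..}. A k n) \<le> ennreal (1 / Suc k)" .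
    qed
    finally show ?thesis .
  qed
  have "emeasure S (\<Inter>k. Q k) \<le> ennreal e" if "e > 0" for e
  proof -
    obtain k where "1 / Suc k < e" using \<open>e > 0\<close> nat_approx_posE by blast
    have "emeasure S (\<Inter>k. Q k) \<le> emeasure S (Q k)" by (intro emeasure_mono) auto
    also have "\<dots> \<le> ennreal (1 / Suc k)" by (rule Q)
    also have "\<dots> \<le> ennreal e" using \<open>1 / Suc k < e\<close> by (intro ennreal_leI) simp
    finally show ?thesis .
  qed
  then have "emeasure S (\<Inter>k. Q k) = 0"
    by (metis add.left_neutral bot_ennreal ennreal_le_epsilon le_bot zero_less_one)
  then have "(\<Inter>k. Q k) \<in> null_sets S" by (auto intro!: null_setsI)
  then show ?thesis
  proof (rule AE_I', intro subsetI INT_I)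
    fix \<omega> k assume "\<omega> \<in> {\<omega> \<in> space S. \<not> \<not> ((\<forall>\<^sub>F n in sequentially. norm (X (r n) \<eta> \<omega>) < R0) \<and>
      filterlim (\<lambda>n. \<kappa> (X (r n) \<eta> \<omega>)) at_top sequentially)}"
    then have \<omega>: "\<omega> \<in> space S" "\<forall>\<^sub>F n in sequentially. norm (X (r n) \<eta> \<omega>) < R0"
      "filterlim (\<lambda>n. \<kappa> (X (r n) \<eta> \<omega>)) at_top sequentially" by auto
    have "\<forall>\<^sub>F n in sequentially. L k \<le> \<kappa> (X (r n) \<eta> \<omega>)"
      using \<omega>(3) by (simp add: filterlim_at_top)
    with \<omega>(2) have "\<forall>\<^sub>F n in sequentially. \<omega> \<in> A k n"
      by eventually_elim (use \<omega>(1) in \<open>simp add: A_def\<close>)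
    then show "\<omega> \<in> Q k" by (auto simp: Q_def eventually_sequentially)
  qed
qed

theorem exit_limit:
  assumes \<eta>: "\<eta> \<in> V"
  obtains r Y where "strict_mono r" "Y \<in> borel_measurable S"
    "AE \<omega> in S. (\<lambda>n. X (r n) \<eta> \<omega>) \<longlonglongrightarrow> Y \<omega> \<and> norm (Y \<omega>) = \<rho>"
proof -
  obtain r where r: "strict_mono r" "AE \<omega> in S. Cauchy (\<lambda>i. X (r i) \<eta> \<omega>)"
    using X_Cauchy_subseq[OF \<eta>] by blast
  define Y where "Y \<omega> = lim (\<lambda>i. X (r i) \<eta> \<omega>)" for \<omega>
  have Y[measurable]: "Y \<in> borel_measurable S" unfolding Y_def by measurable
  have \<rho>: "\<rho> > 0" using \<eta> V_ball by (metis mem_ball_0 norm_ge_zero order_le_less_trans subsetD)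
  \<comment> \<open>Countably many radii increasing to \<open>\<rho>\<close>, so that a single null
    set serves every possible interior limit.\<close>
  define R where "R k = \<rho> * (1 - 1 / Suc k)" for k :: nat
  have R: "0 \<le> R k" "R k < \<rho>" for k using \<rho> by (auto simp: R_def field_simps)
  have "AE \<omega> in S. \<forall>k. \<not> ((\<forall>\<^sub>F n in sequentially. norm (X (r n) \<eta> \<omega>) < R k) \<and>
    filterlim (\<lambda>n. \<kappa> (X (r n) \<eta> \<omega>)) at_top sequentially)"
    unfolding AE_all_countable using no_interior_blowup[OF \<eta> R] by blast
  with r(2) X_steps_tendsto_0[OF \<eta>] have "AE \<omega> in S. (\<lambda>n. X (r n) \<eta> \<omega>) \<longlonglongrightarrow> Y \<omega> \<and> norm (Y \<omega>) = \<rho>"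
  proof eventually_elim
    case (elim \<omega>)
    have lim: "(\<lambda>n. X (r n) \<eta> \<omega>) \<longlonglongrightarrow> Y \<omega>"
      using elim(1) unfolding Y_def by (simp add: Cauchy_convergent_iff convergent_LIMSEQ_iff)
    have "norm (Y \<omega>) \<le> \<rho>"
      using X_in[OF \<eta>] norm_V_le by (intro LIMSEQ_le_const2[OF tendsto_norm[OF lim]]) auto
    moreover have "\<not> norm (Y \<omega>) < \<rho>"
    proof
      assume lt: "norm (Y \<omega>) < \<rho>"
      from dichotomy[OF lt] show False
      proof (elim disjE exE conjE)
        fix \<delta> N assume N: "0 < \<delta>" "open N" "Y \<omega> \<in> N" "\<forall>\<eta>\<in>N \<inter> V. \<forall>t. \<delta> \<le> norm (\<Phi> \<eta> t - \<eta>)"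
        have "\<forall>\<^sub>F n in sequentially. X (r n) \<eta> \<omega> \<in> N" using lim N(2,3) by (simp add: tendsto_def)
        \<comment> \<open>\<open>Suc (r n)\<close> need not be a selected time; this is where the
          full sequence of steps is used.\<close>
        moreover have "(\<lambda>n. X (Suc (r n)) \<eta> \<omega> - X (r n) \<eta> \<omega>) \<longlonglongrightarrow> 0"
          using LIMSEQ_subseq_LIMSEQ[OF elim(2) r(1)] by (simp add: o_def del: X.simps)
        then have "\<forall>\<^sub>F n in sequentially. norm (X (Suc (r n)) \<eta> \<omega> - X (r n) \<eta> \<omega>) < \<delta>"
          using N(1) by (simp add: tendsto_iff dist_norm del: X.simps)
        ultimately have "\<forall>\<^sub>F n in sequentially. False"
          by eventually_elim (use N(4) X_in[OF \<eta>] in \<open>auto simp: X_Suc not_less[symmetric] simp del: X.simps\<close>)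
        then show False by simp
      next
        assume N: "\<forall>L. \<exists>N. open N \<and> Y \<omega> \<in> N \<and> (\<forall>\<eta>\<in>N \<inter> V. L \<le> \<kappa> \<eta>)"
        have "\<exists>k. norm (Y \<omega>) < R k"
        proof -
          have "R \<longlonglongrightarrow> \<rho> * (1 - 0)" unfolding R_def by (intro tendsto_intros LIMSEQ_Suc[OF lim_1_over_n])
          then have "\<forall>\<^sub>F k in sequentially. norm (Y \<omega>) < R k" using lt by (intro order_tendstoD(1)) auto
          then show ?thesis using eventually_happens by fastforce
        qed
        then obtain k where k: "norm (Y \<omega>) < R k" by blast
        have "\<forall>\<^sub>F n in sequentially. norm (X (r n) \<eta> \<omega>) < R k"
          using k by (intro order_tendstoD(2)[OF tendsto_norm[OF lim]])
        moreover have "filterlim (\<lambda>n. \<kappa> (X (r n) \<eta> \<omega>)) at_top sequentially"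
          unfolding filterlim_at_top
        proof
          fix L
          obtain N where "open N" "Y \<omega> \<in> N" "\<forall>\<eta>\<in>N \<inter> V. L \<le> \<kappa> \<eta>" using N by blast
          then have "\<forall>\<^sub>F n in sequentially. X (r n) \<eta> \<omega> \<in> N" using lim by (simp add: tendsto_def)
          then show "\<forall>\<^sub>F n in sequentially. L \<le> \<kappa> (X (r n) \<eta> \<omega>)"
            by eventually_elim (use \<open>\<forall>\<eta>\<in>N \<inter> V. L \<le> \<kappa> \<eta>\<close> X_in[OF \<eta>] in auto)
        qed
        ultimately show False using elim(3) by blast
      qed
    qed
    ultimately show ?case using lim by auto
  qed
  with r(1) Y show thesis by (rule that)
qed

end

section \<open>Level sets in two complex variables\<close>

definition unit_interval :: "real measure" where "unit_interval = uniform_measure lborel {0..1}"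

lemma prob_space_unit_interval: "prob_space unit_interval"
  unfolding unit_interval_def by (rule prob_space_uniform_measure) auto

lemma sets_unit_interval[measurable_cong]: "sets unit_interval = sets borel"
  by (simp add: unit_interval_def)

lemma integral_unit_interval:
  fixes f :: "real \<Rightarrow> complex"
  assumes c: "continuous_on UNIV f"
  shows "(LINT t|unit_interval. f t) = integral {0..1} f"
proof -
  have [measurable]: "f \<in> borel_measurable borel" using c by (rule borel_measurable_continuous_onI)
  have "unit_interval = density lborel (indicator {0..1})"
    unfolding unit_interval_def uniform_measure_def by (intro density_cong) (auto intro!: AE_I2 split: split_indicator simp: ennreal_divide_self)
  also have "\<dots> = density lborel (\<lambda>x. ennreal (indicator {0..1} x))" by (simp add: ennreal_indicator)
  finally have eq: "unit_interval = density lborel (\<lambda>x. ennreal (indicator {0..1} x))" .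
  have "(LINT t|unit_interval. f t) = (LINT t|lborel. indicator {0..1} t *\<^sub>R f t)"
    unfolding eq by (subst integral_density) auto
  also have "\<dots> = (LBINT t:{0..1}. f t)" by (simp add: set_lebesgue_integral_def)
  also have "\<dots> = integral {0..1} f"
    using c by (intro set_borel_integral_eq_integral borel_integrable_atLeastAtMost')
      (auto intro: continuous_on_subset)
  finally show ?thesis .
qed

lemma continuous_on_circle:
  assumes "continuous_on (cball w r) f" "0 \<le> r"
  shows "continuous_on UNIV (\<lambda>t. f (w + of_real r * exp (2 * of_real pi * \<i> * of_real t)))"
proof (rule continuous_on_compose2[OF assms(1)])
  show "range (\<lambda>t. w + complex_of_real r * exp (2 * complex_of_real pi * \<i> * complex_of_real t)) \<subseteq> cball w r"
    using assms by (auto simp: dist_norm norm_mult)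
qed (intro continuous_intros)

text \<open>In Cauchy's formula the denominator cancels against the derivative of the circle, which
  leaves the mean over the parameter up to the constant \<open>2 * pi * \<i>\<close>.\<close>

lemma integral_circle_mean:
  assumes hol: "f holomorphic_on ball w R" and r: "0 < r" "r < R"
  shows "(LINT t|unit_interval. f (w + of_real r * exp (2 * of_real pi * \<i> * of_real t))) = f w"
proof -
  define c where "c = 2 * complex_of_real pi * \<i>"
  have c: "c \<noteq> 0" by (simp add: c_def)
  have sub: "cball w r \<subseteq> ball w R" using r by auto
  have cont: "continuous_on (cball w r) f" using hol sub holomorphic_on_imp_continuous_on continuous_on_subset by blast
  have "((\<lambda>u. f u/(u-w)) has_contour_integral (2 * of_real pi * \<i> * f w)) (circlepath w r)"
    using hol sub r by (intro Cauchy_integral_circlepath cont holomorphic_on_subset[OF hol]) auto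
  then have "((\<lambda>t. f (circlepath w r t) / (circlepath w r t - w) * (2 * pi * \<i> * r * exp(2 * of_real pi * \<i> * t))) has_integral (2 * of_real pi * \<i> * f w)) {0..1}"
    unfolding has_contour_integral_def
    by (rule has_integral_eq[rotated]) (simp add: vector_derivative_circlepath01)
  then have "((\<lambda>t. (2 * of_real pi * \<i>) * f (w + of_real r * exp (2 * of_real pi * \<i> * of_real t))) has_integral (2 * of_real pi * \<i> * f w)) {0..1}"
    by (rule has_integral_eq[rotated]) (use r in \<open>simp add: circlepath field_simps\<close>)
  then have "((\<lambda>t. inverse c * (c * f (w + of_real r * exp (2 * of_real pi * \<i> * of_real t)))) has_integral inverse c * (c * f w)) {0..1}"
    unfolding c_def[symmetric] by (rule has_integral_mult_right)
  then have "((\<lambda>t. f (w + of_real r * exp (2 * of_real pi * \<i> * of_real t))) has_integral f w) {0..1}"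
    using c by (simp add: mult.assoc[symmetric])
  then show ?thesis
    using continuous_on_circle[OF cont] r by (simp add: integral_unit_interval integral_unique)
qed

text \<open>Only pointwise complex differentiability is assumed, in keeping with
  \<open>holomorphic_cn_on\<close>. Continuity of the partial derivatives and holomorphy of
  \<open>Fy\<close> along curves are derived from it.\<close>

locale holomorphic_slice =
  fixes F Fx Fy :: "complex \<times> complex \<Rightarrow> complex" and \<rho> :: real
  assumes F_deriv: "z \<in> ball 0 \<rho> \<Longrightarrow> (F has_derivative (\<lambda>v. Fx z * fst v + Fy z * snd v)) (at z)"
begin

section \<open>Regularity of the partial derivatives and graph charts\<close>

lemma F_continuous: "continuous_on (ball 0 \<rho>) F"
  using F_deriv has_derivative_continuous continuous_at_imp_continuous_on by blast

lemma F_curve_deriv: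
  assumes "(p has_field_derivative p') (at w)" "(q has_field_derivative q') (at w)" "(p w, q w) \<in> ball 0 \<rho>"
  shows "((\<lambda>w. F (p w, q w)) has_field_derivative (Fx (p w, q w) * p' + Fy (p w, q w) * q')) (at w)"
proof -
  have "((\<lambda>w. (p w, q w)) has_derivative (\<lambda>h. (p' * h, q' * h))) (at w)"
    using assms(1,2) unfolding has_field_derivative_def by (rule has_derivative_Pair)
  from has_derivative_compose[OF this F_deriv[OF assms(3)]]
  show ?thesis unfolding has_field_derivative_def
    by (rule has_derivative_eq_rhs) (auto simp: algebra_simps fun_eq_iff)
qed

lemma F_curve_holomorphic:
  assumes "open A" "p holomorphic_on A" "q holomorphic_on A" "\<And>w. w \<in> A \<Longrightarrow> (p w, q w) \<in> ball 0 \<rho>"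
  shows "(\<lambda>w. F (p w, q w)) holomorphic_on A"
  unfolding holomorphic_on_open[OF assms(1)]
  using F_curve_deriv[OF holomorphic_derivI[OF assms(2,1)] holomorphic_derivI[OF assms(3,1)]] assms(4) by blast

text \<open>Cauchy's estimate at 0 is applied to the one-variable function
  \<open>F (z + t e) - F (z0 + t e)\<close>, which is uniformly small in \<open>t\<close> because
  \<open>F\<close> is uniformly continuous on a compact ball.\<close>

lemma directional_continuous:
  assumes e: "norm e \<le> 1"
  shows "continuous_on (ball 0 \<rho>) (\<lambda>z. Fx z * fst e + Fy z * snd e)"
proof (rule continuous_at_imp_continuous_on, rule ballI)
  fix z0 :: "complex \<times> complex" assume z0: "z0 \<in> ball 0 \<rho>"
  define D where "D z = Fx z * fst e + Fy z * snd e" for z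
  \<comment> \<open>A shift by at most \<open>r\<close> from a point within \<open>r\<close> of
    \<open>z0\<close> stays within \<open>2*r\<close>, still strictly inside the ball of radius
    \<open>\<rho>\<close>.\<close>
  define r where "r = (\<rho> - norm z0) / 3"
  have r: "r > 0" using z0 by (simp add: r_def)
  define shift where "shift z t = (fst z + t * fst e, snd z + t * snd e)" for z :: "complex \<times> complex" and t
  have shift_eq: "shift z t = z + (t * fst e, t * snd e)" for z t by (simp add: shift_def prod_eq_iff)
  have ne: "norm (t * fst e, t * snd e) \<le> norm t" for t
  proof -
    have "norm (t * fst e, t * snd e) = sqrt ((norm t)\<^sup>2 * ((norm (fst e))\<^sup>2 + (norm (snd e))\<^sup>2))"
      by (simp add: norm_Pair norm_mult power_mult_distrib algebra_simps)
    also have "\<dots> = norm t * norm e" by (simp add: real_sqrt_mult norm_prod_def)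
    also have "\<dots> \<le> norm t" using e by (simp add: mult_left_le)
    finally show ?thesis .
  qed
  have sh_in: "shift z t \<in> cball z0 (2*r)" if "dist z z0 < r" "norm t \<le> r" for z t
  proof -
    have "norm (shift z t - z0) \<le> norm (z - z0) + norm (t * fst e, t * snd e)"
      unfolding shift_eq by (metis add_diff_eq add.commute add_diff_cancel_left' diff_add_eq norm_triangle_ineq)
    also have "\<dots> \<le> r + r" using that ne[of t] by (simp add: dist_norm)
    finally show ?thesis by (simp add: dist_norm norm_minus_commute)
  qed
  have sub: "cball z0 (2*r) \<subseteq> ball 0 \<rho>"
  proof
    fix x assume "x \<in> cball z0 (2*r)"
    then have "norm x \<le> norm z0 + 2*r" using norm_triangle_sub[of x z0] by (simp add: dist_norm norm_minus_commute)
    also have "\<dots> < \<rho>" using z0 by (simp add: r_def field_simps)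
    finally show "x \<in> ball 0 \<rho>" by simp
  qed
  have "uniformly_continuous_on (cball z0 (2*r)) F"
    using sub F_continuous continuous_on_subset by (intro compact_uniformly_continuous) auto
  have der: "((\<lambda>t. F (shift z t)) has_field_derivative D (shift z t)) (at t)"
    if "dist z z0 < r" "norm t \<le> r" for z t
  proof -
    have "((\<lambda>t. F (fst z + t * fst e, snd z + t * snd e)) has_field_derivative
      (Fx (fst z + t * fst e, snd z + t * snd e) * fst e + Fy (fst z + t * fst e, snd z + t * snd e) * snd e)) (at t)"
      using sh_in[OF that] sub by (intro F_curve_deriv) (auto intro!: derivative_eq_intros simp: shift_def)
    then show ?thesis by (simp add: D_def shift_def)
  qed
  have "isCont D z0"
    unfolding isCont_def LIM_def
  proof (intro allI impI)
    fix \<epsilon> :: real assume \<epsilon>: "\<epsilon> > 0"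
    then obtain \<delta> where \<delta>: "\<delta> > 0" "\<And>x y. x \<in> cball z0 (2*r) \<Longrightarrow> y \<in> cball z0 (2*r) \<Longrightarrow> dist x y < \<delta> \<Longrightarrow> dist (F x) (F y) < \<epsilon> * r / 2"
      using \<open>uniformly_continuous_on (cball z0 (2*r)) F\<close> r unfolding uniformly_continuous_on_def
      by (metis divide_pos_pos mult_pos_pos zero_less_numeral)
    show "\<exists>s>0. \<forall>z. z \<noteq> z0 \<and> dist z z0 < s \<longrightarrow> dist (D z) (D z0) < \<epsilon>"
    proof (intro exI[of _ "min \<delta> r"] conjI allI impI)
      fix z assume "z \<noteq> z0 \<and> dist z z0 < min \<delta> r"
      then have z: "dist z z0 < \<delta>" "dist z z0 < r" by auto
      have z0r: "dist z0 z0 < r" using r by simp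
      define G where "G t = F (shift z t) - F (shift z0 t)" for t
      have G': "(G has_field_derivative D (shift z t) - D (shift z0 t)) (at t)" if "norm t \<le> r" for t
        unfolding G_def by (intro DERIV_diff der z z0r that)
      have Gh: "G holomorphic_on ball 0 r"
        unfolding holomorphic_on_open[OF open_ball] using G' by (metis dist_0_norm less_imp_le mem_ball)
      have Gc: "continuous_on (cball 0 r) G"
        by (intro continuous_at_imp_continuous_on ballI DERIV_isCont[OF G']) simp
      have "norm ((deriv ^^ 1) G 0) \<le> fact 1 * (\<epsilon> * r / 2) / r ^ 1"
      proof (rule Cauchy_inequality[OF Gh Gc r])
        fix t :: complex assume "norm (0 - t) = r"
        then have t: "norm t \<le> r" by simp
        have "dist (shift z t) (shift z0 t) < \<delta>" using z(1) by (simp add: shift_eq)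
        then show "norm (G t) \<le> \<epsilon> * r / 2"
          using \<delta>(2)[OF sh_in[OF z(2) t] sh_in[OF z0r t]] by (simp add: G_def dist_norm)
      qed
      moreover have "deriv G 0 = D z - D z0" using DERIV_imp_deriv[OF G'[of 0]] r by (simp add: shift_def)
      ultimately show "dist (D z) (D z0) < \<epsilon>" using r \<epsilon> by (simp add: dist_norm)
    qed (use \<delta> r in auto)
  qed
  then show "isCont (\<lambda>z. Fx z * fst e + Fy z * snd e) z0" unfolding D_def .
qed

lemma Fx_continuous: "continuous_on (ball 0 \<rho>) Fx"
  using directional_continuous[of "(1, 0)"] by (simp add: norm_Pair)

lemma Fy_continuous: "continuous_on (ball 0 \<rho>) Fy"
  using directional_continuous[of "(0, 1)"] by (simp add: norm_Pair)

text \<open>Along the curve, \<open>Fy\<close> is a locally uniform limit of difference quotients of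
  \<open>F\<close> in the second variable. These are holomorphic in the parameter, so Weierstrass's
  theorem applies and second derivatives are avoided.\<close>

lemma Fy_curve_holomorphic:
  assumes A: "open A" and p: "p holomorphic_on A" and q: "q holomorphic_on A"
    and in_ball: "\<And>w. w \<in> A \<Longrightarrow> (p w, q w) \<in> ball 0 \<rho>"
  shows "(\<lambda>w. Fy (p w, q w)) holomorphic_on A"
proof -
  have "\<exists>s>0. (\<lambda>w. Fy (p w, q w)) holomorphic_on ball w0 s" if w0: "w0 \<in> A" for w0
  proof -
    obtain s where s: "s > 0" "cball w0 s \<subseteq> A" using A w0 open_contains_cball by blast
    have pqc: "continuous_on A p" "continuous_on A q" using p q holomorphic_on_imp_continuous_on by auto
    define K where "K = (\<lambda>w. (p w, q w)) ` cball w0 s"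
    have "compact K" unfolding K_def
      using pqc s by (intro compact_continuous_image continuous_on_Pair) (auto intro: continuous_on_subset)
    have "K \<subseteq> ball 0 \<rho>" using in_ball s by (auto simp: K_def)
    then obtain \<delta> where \<delta>: "\<delta> > 0" "{x + y |x y. x \<in> K \<and> y \<in> cball 0 \<delta>} \<subseteq> ball 0 \<rho>"
    proof -
      obtain e where e: "e > 0" "(\<Union>x\<in>K. cball x e) \<subseteq> ball 0 \<rho>"
        using compact_subset_open_imp_cball_epsilon_subset[OF \<open>compact K\<close> open_ball \<open>K \<subseteq> ball 0 \<rho>\<close>] by blast
      have "x + y \<in> ball 0 \<rho>" if "x \<in> K" "y \<in> cball 0 e" for x y
      proof -
        have "x + y \<in> cball x e" using that(2) by (simp add: dist_norm)
        then show ?thesis using e(2) that(1) by blast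
      qed
      then have "{x + y |x y. x \<in> K \<and> y \<in> cball 0 e} \<subseteq> ball 0 \<rho>" by blast
      with e(1) show ?thesis by (rule that)
    qed
    \<comment> \<open>A compact thickening of the curve that contains all small shifts; uniform
      continuity of \<open>Fy\<close> on it makes the quotients converge uniformly.\<close>
    define K' where "K' = {x + y |x y. x \<in> K \<and> y \<in> cball 0 \<delta>}"
    have "compact K'" unfolding K'_def by (intro compact_sums \<open>compact K\<close> compact_cball)
    have uc: "uniformly_continuous_on K' Fy"
      using \<delta>(2) Fy_continuous continuous_on_subset \<open>compact K'\<close> unfolding K'_def
      by (intro compact_uniformly_continuous) auto
    define Q where "Q n w = of_nat (Suc n) * (F (p w, q w + 1 / of_nat (Suc n)) - F (p w, q w))" for n w
    have near: "(p w, q w + t) \<in> K'" if "w \<in> cball w0 s" "norm t \<le> \<delta>" for w t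
    proof -
      have "(p w, q w + t) = (p w, q w) + (0, t)" by simp
      moreover have "(p w, q w) \<in> K" using that by (auto simp: K_def)
      moreover have "(0, t) \<in> cball (0::complex \<times> complex) \<delta>" using that by (simp add: norm_Pair)
      ultimately show ?thesis unfolding K'_def by blast
    qed
    have K'ball: "K' \<subseteq> ball 0 \<rho>" using \<delta>(2) by (simp add: K'_def)
    have small: "\<forall>\<^sub>F n in sequentially. 1 / real (Suc n) < d" if "d > 0" for d :: real
      using that LIMSEQ_Suc[OF lim_1_over_n] by (intro order_tendstoD(2)) auto
    have hol: "\<forall>\<^sub>F n in sequentially. continuous_on (cball w0 s) (Q n) \<and> Q n holomorphic_on ball w0 s"
      using small[OF \<delta>(1)]
    proof eventually_elim
      case (elim n)
      obtain t :: complex where t: "t = 1 / of_nat (Suc n)" by simp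
      have nt: "norm t \<le> \<delta>" using elim unfolding t by (simp add: norm_divide del: of_nat_Suc)
      \<comment> \<open>The shifted curve may leave the ball for some parameters in
        \<open>A\<close>; \<open>A'\<close> is the open part where it does not, and it contains the
        closed disc.\<close>
      define A' where "A' = A \<inter> (\<lambda>w. (p w, q w + t)) -` ball 0 \<rho>"
      have "open A'" unfolding A'_def
        using A pqc by (intro continuous_open_preimage continuous_intros) auto
      have "Q n holomorphic_on A'"
        unfolding Q_def t[symmetric]
        using p q in_ball \<open>open A'\<close>
        by (intro holomorphic_intros F_curve_holomorphic holomorphic_on_subset[OF p] holomorphic_on_subset[OF q]) (auto simp: A'_def)
      moreover have "cball w0 s \<subseteq> A'"
      proof
        fix w assume w: "w \<in> cball w0 s"
        then show "w \<in> A'" using subsetD[OF K'ball near[OF w nt]] s by (auto simp: A'_def)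
      qed
      ultimately show ?case
        by (meson ball_subset_cball continuous_on_subset holomorphic_on_imp_continuous_on holomorphic_on_subset)
    qed
    have "uniform_limit (cball w0 s) Q (\<lambda>w. Fy (p w, q w)) sequentially"
    proof (rule uniform_limitI)
      fix e :: real assume e: "e > 0"
      obtain d where d: "d > 0" "\<And>x y. x \<in> K' \<Longrightarrow> y \<in> K' \<Longrightarrow> dist x y < d \<Longrightarrow> dist (Fy x) (Fy y) < e/2"
        using uc e unfolding uniformly_continuous_on_def by (metis half_gt_zero)
      show "\<forall>\<^sub>F n in sequentially. \<forall>w\<in>cball w0 s. dist (Q n w) (Fy (p w, q w)) < e"
        using small[OF \<delta>(1)] small[OF d(1)]
      proof eventually_elim
        case (elim n)
        obtain \<tau> :: complex where t: "\<tau> = 1 / of_nat (Suc n)" by simp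
        have nt: "norm \<tau> \<le> \<delta>" "norm \<tau> < d" "\<tau> \<noteq> 0"
          using elim unfolding t by (simp_all add: norm_divide del: of_nat_Suc)
        show ?case
        proof
          fix w assume w: "w \<in> cball w0 s"
          \<comment> \<open>With the linear term removed, the derivative is a difference of two
            nearby values of \<open>Fy\<close>, and the mean value inequality bounds the error of
            the quotient.\<close>
          define G where "G t = F (p w, q w + t) - t * Fy (p w, q w)" for t
          have "norm (G \<tau> - G 0) \<le> e/2 * norm (\<tau> - 0)"
          proof (rule field_differentiable_bound[of "cball 0 (norm \<tau>)" G "\<lambda>t. Fy (p w, q w + t) - Fy (p w, q w)"])
            fix t :: complex assume t: "t \<in> cball 0 (norm \<tau>)"
            have "(G has_field_derivative (Fx (p w, q w + t) * 0 + Fy (p w, q w + t) * 1) - Fy (p w, q w)) (at t)"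
              unfolding G_def using near[OF w, of t] t nt K'ball
              by (intro DERIV_diff F_curve_deriv) (auto intro!: derivative_eq_intros)
            then show "(G has_field_derivative Fy (p w, q w + t) - Fy (p w, q w)) (at t within cball 0 (norm \<tau>))"
              by (simp add: has_field_derivative_at_within)
            have "dist (Fy (p w, q w + t)) (Fy (p w, q w)) < e/2"
              using near[OF w, of t] near[OF w, of 0] t nt \<delta> by (intro d(2)) (auto simp: dist_Pair_Pair dist_norm)
            then show "norm (Fy (p w, q w + t) - Fy (p w, q w)) \<le> e/2" by (simp add: dist_norm)
          qed auto
          then have "norm (F (p w, q w + \<tau>) - F (p w, q w) - \<tau> * Fy (p w, q w)) \<le> e/2 * norm \<tau>"
            by (simp add: G_def algebra_simps)
          moreover have "Q n w - Fy (p w, q w) = (F (p w, q w + \<tau>) - F (p w, q w) - \<tau> * Fy (p w, q w)) / \<tau>"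
            unfolding Q_def t by (simp add: field_simps del: of_nat_Suc)
          ultimately have "norm (Q n w - Fy (p w, q w)) \<le> e/2"
            using nt(3) by (simp add: norm_divide divide_le_eq)
          then show "dist (Q n w) (Fy (p w, q w)) < e" using e by (simp add: dist_norm)
        qed
      qed
    qed
    then have "(\<lambda>w. Fy (p w, q w)) holomorphic_on ball w0 s"
      using holomorphic_uniform_limit[OF hol] by (metis trivial_limit_sequentially)
    with s(1) show ?thesis by blast
  qed
  then have "(\<lambda>w. Fy (p w, q w)) field_differentiable at w0" if "w0 \<in> A" for w0
    using that by (meson centre_in_ball holomorphic_on_imp_differentiable_at open_ball)
  then show ?thesis
    by (simp add: holomorphic_on_def field_differentiable_at_within)
qed

text \<open>The map \<open>G z = (fst z, F z)\<close> straightens the level set and is invertible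
  near \<open>p\<close> because \<open>Fy p\<close> is nonzero. The second component of its inverse
  along the height \<open>F p\<close> is the graph function \<open>q\<close>.\<close>

lemma level_set_chart:
  assumes p: "p \<in> ball 0 \<rho>" "Fy p \<noteq> 0" and r: "r > 0"
  obtains N e q where "open N" "p \<in> N" "N \<subseteq> ball p r" "e > 0" "q holomorphic_on ball (fst p) (3 * e)"
    "\<And>x. x \<in> ball (fst p) (3 * e) \<Longrightarrow>
      F (x, q x) = F p \<and> Fy (x, q x) \<noteq> 0 \<and> (x, q x) \<in> ball p r \<inter> ball 0 \<rho>"
    "\<And>\<eta>. \<eta> \<in> N \<Longrightarrow> F \<eta> = F p \<Longrightarrow> dist (fst p) (fst \<eta>) < e \<and> snd \<eta> = q (fst \<eta>)"
proof -
  define U where "U = {z \<in> ball 0 \<rho>. Fy z \<noteq> 0} \<inter> ball p r"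
  have "{z \<in> ball 0 \<rho>. Fy z \<noteq> 0} = ball 0 \<rho> \<inter> Fy -` (- {0})" by auto
  then have "open {z \<in> ball 0 \<rho>. Fy z \<noteq> 0}"
    using continuous_open_preimage[OF Fy_continuous open_ball open_Compl[OF closed_singleton]] by simp
  then have U: "open U" "p \<in> U" using p r by (auto simp: U_def)
  define G where "G z = (fst z, F z)" for z
  define G' where "G' z = Blinfun (\<lambda>v. (fst v, Fx z * fst v + Fy z * snd v))" for z
  have bl: "bounded_linear (\<lambda>v. (fst v, A * fst v + B * snd v))" for A B :: complex
    by (intro bounded_linear_Pair bounded_linear_fst bounded_linear_add
        bounded_linear_compose[OF bounded_linear_mult_right] bounded_linear_snd)
  have G'_apply: "blinfun_apply (G' z) = (\<lambda>v. (fst v, Fx z * fst v + Fy z * snd v))" for z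
    unfolding G'_def by (rule bounded_linear_Blinfun_apply[OF bl])
  have derG: "(G has_derivative blinfun_apply (G' z)) (at z)" if "z \<in> U" for z
    unfolding G_def G'_apply using that
    by (intro has_derivative_Pair has_derivative_fst has_derivative_ident F_deriv) (auto simp: U_def)
  have contG': "continuous_on U G'"
      by (rule continuous_on_blinfun_componentwise)
      (auto simp: G'_apply U_def intro!: continuous_intros continuous_on_subset[OF Fx_continuous] continuous_on_subset[OF Fy_continuous])
  define J where "J = Blinfun (\<lambda>v. (fst v, (- Fx p / Fy p) * fst v + (1 / Fy p) * snd v))"
  have J_apply: "blinfun_apply J = (\<lambda>v. (fst v, (- Fx p / Fy p) * fst v + (1 / Fy p) * snd v))"
    unfolding J_def by (rule bounded_linear_Blinfun_apply[OF bl])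
  have J: "J o\<^sub>L G' p = id_blinfun"
    by (rule blinfun_eqI) (use p(2) in \<open>auto simp: J_apply G'_apply prod_eq_iff field_simps\<close>)
  obtain U' W g g' where ift: "open U'" "U' \<subseteq> U" "p \<in> U'" "open W" "G p \<in> W" "homeomorphism U' W G g"
    "\<And>y. y \<in> W \<Longrightarrow> (g has_derivative (g' y)) (at y)"
    by (rule inverse_function_theorem[OF U(1) derG contG' U(2) J], assumption) (rule that; assumption)
  \<comment> \<open>Steps have radius \<open>e\<close> and start within \<open>e\<close> of the
    centre. The factor 3 leaves a disc of radius \<open>2 * e\<close> around every start, so the
    mean value formula has room beyond the circle.\<close>
  obtain e where e: "e > 0" "ball (G p) (3 * e) \<subseteq> W"
  proof -
    obtain d where "d > 0" "ball (G p) d \<subseteq> W" using ift(4,5) open_contains_ball by blast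
    then show ?thesis using that[of "d/3"] by simp
  qed
  define q where "q x = snd (g (x, F p))" for x
  have inW: "(x, F p) \<in> W" if "x \<in> ball (fst p) (3 * e)" for x
    using that e(2) by (auto simp: G_def dist_Pair_Pair)
  have gG: "g (x, F p) = (x, q x)" "(x, q x) \<in> U'" "F (x, q x) = F p" if "x \<in> ball (fst p) (3 * e)" for x
  proof -
    have 1: "G (g (x, F p)) = (x, F p)" "g (x, F p) \<in> U'"
      using inW[OF that] ift(6) by (auto simp: homeomorphism_def)
    then show "g (x, F p) = (x, q x)" by (auto simp: G_def q_def prod_eq_iff)
    with 1 show "(x, q x) \<in> U'" "F (x, q x) = F p" by (auto simp: G_def)
  qed
  have qhol: "q holomorphic_on ball (fst p) (3 * e)"
    unfolding holomorphic_on_open[OF open_ball]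
  proof
    fix x assume x: "x \<in> ball (fst p) (3 * e)"
    have xU: "(x, q x) \<in> ball 0 \<rho>" "Fy (x, q x) \<noteq> 0" using gG(2)[OF x] ift(2) by (auto simp: U_def)
    have "((\<lambda>x. (x, F p)) has_derivative (\<lambda>h. (h, 0))) (at x)"
      by (intro has_derivative_Pair has_derivative_ident has_derivative_const)
    from has_derivative_snd[OF has_derivative_compose[OF this ift(7)[OF inW[OF x]]]]
    obtain D where D: "(q has_derivative D) (at x)" unfolding q_def by blast
    have pair: "((\<lambda>x. (x, q x)) has_derivative (\<lambda>h. (h, D h))) (at x)"
      by (intro has_derivative_Pair has_derivative_ident D)
    \<comment> \<open>The inverse function theorem gives only a real derivative \<open>D\<close>.
      Differentiating the constant \<open>F (x, q x)\<close> determines \<open>D\<close> as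
      multiplication by \<open>- Fx / Fy\<close>, hence complex linear.\<close>
    have "((\<lambda>x. F (x, q x)) has_derivative (\<lambda>h. Fx (x, q x) * h + Fy (x, q x) * D h)) (at x)"
      using has_derivative_compose[OF pair F_deriv[OF xU(1)]] by simp
    moreover have "((\<lambda>x. F (x, q x)) has_derivative (\<lambda>h. 0)) (at x)"
      by (rule has_derivative_transform_within_open[OF has_derivative_const[of "F p"] open_ball x])
        (use gG(3) in auto)
    ultimately have "(\<lambda>h. Fx (x, q x) * h + Fy (x, q x) * D h) = (\<lambda>h. 0)"
      by (rule has_derivative_unique)
    then have "Fy (x, q x) * D h = - Fx (x, q x) * h" for h
      by (metis add_eq_0_iff2 mult_minus_left add.commute)
    then have "D = (*) (- Fx (x, q x) / Fy (x, q x))"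
      using xU(2) by (auto simp: fun_eq_iff field_simps)
    then show "\<exists>f'. (q has_field_derivative f') (at x)"
      using D unfolding has_field_derivative_def by blast
  qed
  show thesis
  proof (rule that[of "U' \<inter> {\<eta>. dist (fst p) (fst \<eta>) < e}" e q])
    show "open (U' \<inter> {\<eta>. dist (fst p) (fst \<eta>) < e})"
      by (intro open_Int ift(1) open_Collect_less continuous_intros)
    show "U' \<inter> {\<eta>. dist (fst p) (fst \<eta>) < e} \<subseteq> ball p r" using ift(2) by (auto simp: U_def)
    show "F (x, q x) = F p \<and> Fy (x, q x) \<noteq> 0 \<and> (x, q x) \<in> ball p r \<inter> ball 0 \<rho>"
      if "x \<in> ball (fst p) (3 * e)" for x
      using gG(2,3)[OF that] ift(2) by (auto simp: U_def)
    show "dist (fst p) (fst \<eta>) < e \<and> snd \<eta> = q (fst \<eta>)"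
      if "\<eta> \<in> U' \<inter> {\<eta>. dist (fst p) (fst \<eta>) < e}" "F \<eta> = F p" for \<eta>
    proof -
      have "g (G \<eta>) = \<eta>" using that(1) ift(6) by (auto simp: homeomorphism_def)
      then show ?thesis using that by (simp add: q_def G_def)
    qed
  qed (use ift e qhol in auto)
qed

text \<open>
  The last property keeps one step from a ball of radius \<open>R < \<rho>\<close> inside a fixed smaller ball of
  \<open>ball 0 \<rho>\<close>, where \<open>Fy\<close> is bounded.
\<close>
lemma level_set_atlas:
  fixes a :: complex
  defines "V \<equiv> {z \<in> ball 0 \<rho>. F z = a \<and> Fy z \<noteq> 0}"
  assumes ne: "V \<noteq> {}"
  obtains N :: "nat \<Rightarrow> (complex \<times> complex) set" and e :: "nat \<Rightarrow> real" and c :: "nat \<Rightarrow> complex" and q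
  where "\<And>k. open (N k)" "V \<subseteq> (\<Union>k. N k)" "\<And>k. e k > 0"
    "\<And>k. q k holomorphic_on ball (c k) (3 * e k)"
    "\<And>k \<eta>. \<eta> \<in> N k \<inter> V \<Longrightarrow> dist (c k) (fst \<eta>) < e k \<and> snd \<eta> = q k (fst \<eta>)"
    "\<And>k x. x \<in> ball (c k) (3 * e k) \<Longrightarrow> (x, q k x) \<in> V"
    "\<And>k \<eta> x. \<eta> \<in> N k \<inter> V \<Longrightarrow> x \<in> ball (c k) (3 * e k) \<Longrightarrow> norm (x, q k x) \<le> norm \<eta> + 2/3 * (\<rho> - norm \<eta>)"
proof -
  define chart where "chart p N e q \<longleftrightarrow> open N \<and> p \<in> N \<and> N \<subseteq> ball p ((\<rho> - norm p) / 4) \<and> e > 0 \<and>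
    q holomorphic_on ball (fst p) (3 * e) \<and>
    (\<forall>x\<in>ball (fst p) (3 * e). (x, q x) \<in> V \<and> (x, q x) \<in> ball p ((\<rho> - norm p) / 4)) \<and>
    (\<forall>\<eta>\<in>N \<inter> V. dist (fst p) (fst \<eta>) < e \<and> snd \<eta> = q (fst \<eta>))"
    for p :: "complex \<times> complex" and N e and q :: "complex \<Rightarrow> complex"
  have "\<exists>N e q. chart p N e q" if "p \<in> V" for p
  proof -
    have p: "p \<in> ball 0 \<rho>" "Fy p \<noteq> 0" "F p = a" "(\<rho> - norm p) / 4 > 0" using that by (auto simp: V_def)
    obtain N e q where ch: "open N" "p \<in> N" "N \<subseteq> ball p ((\<rho> - norm p) / 4)" "e > 0" "q holomorphic_on ball (fst p) (3 * e)"
      "\<And>x. x \<in> ball (fst p) (3 * e) \<Longrightarrow>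
        F (x, q x) = F p \<and> Fy (x, q x) \<noteq> 0 \<and> (x, q x) \<in> ball p ((\<rho> - norm p) / 4) \<inter> ball 0 \<rho>"
      "\<And>\<eta>. \<eta> \<in> N \<Longrightarrow> F \<eta> = F p \<Longrightarrow> dist (fst p) (fst \<eta>) < e \<and> snd \<eta> = q (fst \<eta>)"
      by (rule level_set_chart[OF p(1,2,4)]) (rule that; assumption)
    have "\<forall>x\<in>ball (fst p) (3 * e). (x, q x) \<in> V \<and> (x, q x) \<in> ball p ((\<rho> - norm p) / 4)"
      using ch(6) p(3) by (simp add: V_def)
    moreover have "\<forall>\<eta>\<in>N \<inter> V. dist (fst p) (fst \<eta>) < e \<and> snd \<eta> = q (fst \<eta>)"
      using ch(7) p(3) by (simp add: V_def)
    ultimately have "chart p N e q" unfolding chart_def using ch(1-5) by simp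
    then show ?thesis by (intro exI)
  qed
  then obtain N e q where ch: "\<And>p. p \<in> V \<Longrightarrow> chart p (N p) (e p) (q p)" by metis
  have chN: "open (N p)" "p \<in> N p" if "p \<in> V" for p
    using ch[OF that] by (simp_all add: chart_def)
  have "open S" if "S \<in> N ` V" for S using that chN(1) by fast
  \<comment> \<open>Charts indexed by natural numbers allow the chart at a given position to be
    chosen measurably.\<close>
  from Lindelof[OF this] obtain \<F>' where F': "\<F>' \<subseteq> N ` V" "countable \<F>'" "\<Union>\<F>' = \<Union>(N ` V)" .
  obtain P where P: "P \<subseteq> V" "countable P" "\<F>' = N ` P"
    using countable_subset_image[of \<F>' N V] F' by auto
  have cover: "V \<subseteq> (\<Union>p\<in>P. N p)"
  proof -
    have "V \<subseteq> \<Union>(N ` V)" using chN(2) by fast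
    then show ?thesis using F'(3) P(3) by simp
  qed
  then have "P \<noteq> {}" using ne by auto
  define p where "p = from_nat_into P"
  have p: "p k \<in> V" for k using P(1) from_nat_into[OF \<open>P \<noteq> {}\<close>] by (auto simp: p_def)
  have rP: "range p = P" unfolding p_def by (rule range_from_nat_into[OF \<open>P \<noteq> {}\<close> P(2)])
  have cp: "open (N (p k))" "N (p k) \<subseteq> ball (p k) ((\<rho> - norm (p k)) / 4)" "e (p k) > 0"
      "q (p k) holomorphic_on ball (fst (p k)) (3 * e (p k))" for k
    using ch[OF p[of k]] by (simp_all add: chart_def)
  have cp2: "(x, q (p k) x) \<in> V" "(x, q (p k) x) \<in> ball (p k) ((\<rho> - norm (p k)) / 4)"
    if "x \<in> ball (fst (p k)) (3 * e (p k))" for k x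
    using ch[OF p[of k]] that by (simp_all add: chart_def)
  have cp3: "dist (fst (p k)) (fst \<eta>) < e (p k) \<and> snd \<eta> = q (p k) (fst \<eta>)" if "\<eta> \<in> N (p k) \<inter> V" for k \<eta>
    using ch[OF p[of k]] that by (simp add: chart_def)
  show thesis
  proof (rule that[of "\<lambda>k. N (p k)" "\<lambda>k. e (p k)" "\<lambda>k. q (p k)" "\<lambda>k. fst (p k)"])
    show "V \<subseteq> (\<Union>k. N (p k))" using cover rP by blast
    fix k \<eta> x assume \<eta>: "\<eta> \<in> N (p k) \<inter> V" and x: "x \<in> ball (fst (p k)) (3 * e (p k))"
    \<comment> \<open>With \<open>s = \<rho> - norm (p k)\<close>, both points lie within
      \<open>s/4\<close> of \<open>p k\<close>. They are less than \<open>s/2\<close> apart, while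
      \<open>\<rho> - norm \<eta>\<close> exceeds \<open>3*s/4\<close>; this is the source of the
      factor \<open>2/3\<close>.\<close>
    have 1: "dist (p k) \<eta> < (\<rho> - norm (p k)) / 4" using subsetD[OF cp(2), of \<eta> k] \<eta> by simp
    have 2: "dist (p k) (x, q (p k) x) < (\<rho> - norm (p k)) / 4" using cp2(2)[OF x] by simp
    have "norm (p k) \<le> norm \<eta> + dist (p k) \<eta>" using norm_triangle_sub[of "p k" \<eta>] by (simp add: dist_norm)
    moreover have "norm (x, q (p k) x) \<le> norm (p k) + dist (p k) (x, q (p k) x)"
      using norm_triangle_sub[of "(x, q (p k) x)" "p k"] by (simp add: dist_norm norm_minus_commute)
    moreover have "norm \<eta> \<le> norm (p k) + dist (p k) \<eta>"
      using norm_triangle_sub[of \<eta> "p k"] by (simp add: dist_norm norm_minus_commute)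
    ultimately show "norm (x, q (p k) x) \<le> norm \<eta> + 2/3 * (\<rho> - norm \<eta>)" using 1 2 by (simp add: field_simps)
  qed (rule cp cp2(1) cp3; assumption)+
qed

end

lemma integrable_circle:
  fixes f :: "complex \<Rightarrow> 'b::{banach, second_countable_topology}"
  assumes c: "continuous_on (cball w r) f" and r: "0 \<le> r"
  shows "integrable unit_interval (\<lambda>t. f (w + of_real r * exp (2 * of_real pi * \<i> * of_real t)))"
proof -
  interpret prob_space unit_interval by (rule prob_space_unit_interval)
  have "bounded (f ` cball w r)" using c compact_continuous_image compact_cball compact_imp_bounded by blast
  then obtain B where "\<And>x. x \<in> cball w r \<Longrightarrow> norm (f x) \<le> B" unfolding bounded_iff by blast
  then show ?thesis
    using r borel_measurable_continuous_onI[OF continuous_on_circle[OF c r]]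
    by (intro integrable_const_bound[of _ B]) (auto intro!: AE_I2 simp: dist_norm norm_mult)
qed

section \<open>The walk by circles in the charts of a level set\<close>

context holomorphic_slice begin

text \<open>An interface that hides the walk: later arguments use only points of the level set,
  their limit and the two mean identities. \<open>Xs\<close> is already the convergent subsequence;
  as its index map is monotone, the identities persist.\<close>

theorem level_set_exit:
  assumes z0: "z0 \<in> ball 0 \<rho>" "Fy z0 \<noteq> 0"
  obtains P :: "real stream measure" and Xs Y where "prob_space P"
    "\<And>n. Xs n \<in> borel_measurable P" "Y \<in> borel_measurable P"
    "\<And>n \<omega>. Xs n \<omega> \<in> ball 0 \<rho>" "\<And>n \<omega>. F (Xs n \<omega>) = F z0"
    "AE \<omega> in P. (\<lambda>n. Xs n \<omega>) \<longlonglongrightarrow> Y \<omega> \<and> norm (Y \<omega>) = \<rho>"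
    "\<And>h hx hy n. holomorphic_slice h hx hy \<rho> \<Longrightarrow> bounded (h ` ball 0 \<rho>) \<Longrightarrow> (LINT \<omega>|P. h (Xs n \<omega>)) = h z0"
    "\<And>h hx hy G n m. holomorphic_slice h hx hy \<rho> \<Longrightarrow> bounded (h ` ball 0 \<rho>) \<Longrightarrow>
      G \<in> borel_measurable borel \<Longrightarrow> bounded (range G) \<Longrightarrow> n \<le> m \<Longrightarrow>
      (LINT \<omega>|P. (G (Xs n \<omega>) :: real) *\<^sub>R h (Xs m \<omega>)) = (LINT \<omega>|P. G (Xs n \<omega>) *\<^sub>R h (Xs n \<omega>))"
proof -
  define V where "V = {z \<in> ball 0 \<rho>. F z = F z0 \<and> Fy z \<noteq> 0}"
  have z0V: "z0 \<in> V" using z0 by (simp add: V_def)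
  then have ne: "{z \<in> ball 0 \<rho>. F z = F z0 \<and> Fy z \<noteq> 0} \<noteq> {}" unfolding V_def by blast
  obtain N :: "nat \<Rightarrow> (complex \<times> complex) set" and e :: "nat \<Rightarrow> real" and c :: "nat \<Rightarrow> complex" and q
    where at: "\<And>k. open (N k)" "V \<subseteq> (\<Union>k. N k)" "\<And>k. e k > 0"
    "\<And>k. q k holomorphic_on ball (c k) (3 * e k)"
    "\<And>k \<eta>. \<eta> \<in> N k \<inter> V \<Longrightarrow> dist (c k) (fst \<eta>) < e k \<and> snd \<eta> = q k (fst \<eta>)"
    "\<And>k x. x \<in> ball (c k) (3 * e k) \<Longrightarrow> (x, q k x) \<in> V"
    "\<And>k \<eta> x. \<eta> \<in> N k \<inter> V \<Longrightarrow> x \<in> ball (c k) (3 * e k) \<Longrightarrow> norm (x, q k x) \<le> norm \<eta> + 2/3 * (\<rho> - norm \<eta>)"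
    by (rule level_set_atlas[OF ne, folded V_def]) (rule that; assumption)
  \<comment> \<open>Near a point of \<open>N i\<close> the least index is at most \<open>i\<close>, so the radii \<open>e (K \<eta>)\<close> are bounded below
    there although the cover is infinite.\<close>
  define K where "K \<eta> = (LEAST k. \<eta> \<in> N k)" for \<eta>
  define circ where "circ w r t = w + of_real r * exp (2 * of_real pi * \<i> * of_real t)" for w :: complex and r t :: real
  \<comment> \<open>The default values here and below only make the maps Borel on the whole space. A
    walk started in \<open>V\<close> stays in \<open>V\<close> and its circles stay in the discs, so
    it never meets them.\<close>
  define q' where "q' k x = (if x \<in> ball (c k) (3 * e k) then q k x else 0)" for k x
  define \<Phi> where "\<Phi> \<eta> t = (if \<eta> \<in> V then (circ (fst \<eta>) (e (K \<eta>)) t, q' (K \<eta>) (circ (fst \<eta>) (e (K \<eta>)) t)) else \<eta>)"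
    for \<eta> t
  define \<kappa> where "\<kappa> z = (if z \<in> V then - ln (norm (Fy z)) else 0)" for z
  have contV: "continuous_on (ball 0 \<rho>) F" "continuous_on (ball 0 \<rho>) Fy"
    by (rule F_continuous Fy_continuous)+
  have [measurable]: "ball (0 :: complex \<times> complex) \<rho> \<in> sets borel" by simp
  define F0 where "F0 z = (if z \<in> ball 0 \<rho> then F z else 0)" for z
  define Fy0 where "Fy0 z = (if z \<in> ball 0 \<rho> then Fy z else 0)" for z
  have mFy[measurable]: "Fy0 \<in> borel_measurable borel" and mF[measurable]: "F0 \<in> borel_measurable borel"
    unfolding F0_def Fy0_def using contV by (intro borel_measurable_continuous_on_if continuous_on_const; simp)+
  have V_sets[measurable]: "V \<in> sets borel"
  proof -
    have "V = {z \<in> space borel. z \<in> ball 0 \<rho> \<and> F0 z = F z0 \<and> Fy0 z \<noteq> 0}"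
      by (auto simp: V_def F0_def Fy0_def)
    also have "\<dots> \<in> sets borel" by measurable
    finally show ?thesis .
  qed
  have [measurable]: "N k \<in> sets borel" for k using at(1) by auto
  have K[measurable]: "K \<in> measurable borel (count_space UNIV)" unfolding K_def by measurable
  have q'[measurable]: "q' k \<in> borel_measurable borel" for k
    unfolding q'_def using holomorphic_on_imp_continuous_on[OF at(4)]
    by (intro borel_measurable_continuous_on_if continuous_on_const; simp)
  have exp_m: "(\<lambda>t. exp (2 * of_real pi * \<i> * of_real t) :: complex) \<in> borel_measurable (borel :: real measure)"
    by (intro borel_measurable_continuous_onI continuous_intros)
  have fst_m: "fst \<in> borel_measurable (borel :: (complex \<times> complex) measure)"
    by (intro borel_measurable_continuous_onI continuous_intros)
  have Phi_m: "(\<lambda>(\<eta>, t). \<Phi> \<eta> t) \<in> borel_measurable (borel \<Otimes>\<^sub>M borel)"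
  proof -
    have "(\<lambda>x. (\<lambda>k x. (circ (fst (fst x)) (e k) (snd x), q' k (circ (fst (fst x)) (e k) (snd x)))) (K (fst x)) x)
      \<in> borel_measurable (borel \<Otimes>\<^sub>M borel)"
    proof (rule measurable_compose_countable)
      fix k
      have [measurable]: "(\<lambda>x. circ (fst (fst x)) (e k) (snd x)) \<in> borel_measurable ((borel :: (complex \<times> complex) measure) \<Otimes>\<^sub>M (borel :: real measure))"
        unfolding circ_def
        by (intro borel_measurable_add borel_measurable_times borel_measurable_const
            measurable_compose[OF measurable_fst fst_m] measurable_compose[OF measurable_snd exp_m])
      show "(\<lambda>x. (circ (fst (fst x)) (e k) (snd x), q' k (circ (fst (fst x)) (e k) (snd x)))) \<in> borel_measurable ((borel :: (complex \<times> complex) measure) \<Otimes>\<^sub>M (borel :: real measure))"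
        by measurable
    qed measurable
    then show ?thesis unfolding \<Phi>_def split_beta by measurable
  qed
  have KN: "\<eta> \<in> N (K \<eta>) \<inter> V" if \<eta>: "\<eta> \<in> V" for \<eta>
  proof -
    obtain k where "\<eta> \<in> N k" using at(2) \<eta> by blast
    then show ?thesis using \<eta> unfolding K_def by (auto intro: LeastI)
  qed
  have circ_in: "circ (fst \<eta>) (e (K \<eta>)) t \<in> ball (c (K \<eta>)) (3 * e (K \<eta>))" if "\<eta> \<in> V" for \<eta> t
  proof -
    have "dist (fst \<eta>) (circ (fst \<eta>) (e (K \<eta>)) t) = e (K \<eta>)"
      using at(3)[of "K \<eta>"] by (simp add: circ_def dist_norm norm_mult)
    then show ?thesis
      using at(3)[of "K \<eta>"] at(5)[OF KN[OF that]] dist_triangle[of "c (K \<eta>)" "circ (fst \<eta>) (e (K \<eta>)) t" "fst \<eta>"] by simp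
  qed
  have Phi_eq: "\<Phi> \<eta> t = (circ (fst \<eta>) (e (K \<eta>)) t, q (K \<eta>) (circ (fst \<eta>) (e (K \<eta>)) t))" if "\<eta> \<in> V" for \<eta> t
    using circ_in[OF that] that by (simp add: \<Phi>_def q'_def)
  have Phi_V: "\<Phi> \<eta> t \<in> V" if "\<eta> \<in> V" for \<eta> t
    using at(6)[OF circ_in[OF that]] Phi_eq[OF that] by simp
  have V_ball: "V \<subseteq> ball 0 \<rho>" by (auto simp: V_def)
  have in_ball: "(x, q k x) \<in> ball 0 \<rho>" if "x \<in> ball (c k) (3 * e k)" for x k
    using at(6)[OF that] V_ball by blast
  \<comment> \<open>On a chart the level set is a graph over the first coordinate, so all mean
    values reduce to holomorphic functions of one variable.\<close>
  have mean: "(LINT t|unit_interval. H (fst (\<Phi> \<eta> t))) = H (fst \<eta>)" "integrable unit_interval (\<lambda>t. H (fst (\<Phi> \<eta> t)))"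
    if "\<eta> \<in> V" "H holomorphic_on ball (c (K \<eta>)) (3 * e (K \<eta>))" for H \<eta>
  proof -
    let ?k = "K \<eta>"
    have sub: "ball (fst \<eta>) (2 * e ?k) \<subseteq> ball (c ?k) (3 * e ?k)"
    proof
      fix x assume "x \<in> ball (fst \<eta>) (2 * e ?k)"
      then show "x \<in> ball (c ?k) (3 * e ?k)"
        using at(5)[OF KN[OF that(1)]] dist_triangle[of "c ?k" x "fst \<eta>"] by simp
    qed
    have hol: "H holomorphic_on ball (fst \<eta>) (2 * e ?k)" using that(2) sub holomorphic_on_subset by blast
    show "(LINT t|unit_interval. H (fst (\<Phi> \<eta> t))) = H (fst \<eta>)"
      using integral_circle_mean[OF hol, of "e ?k"] at(3)[of ?k] by (simp add: Phi_eq[OF that(1)] circ_def)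
    have "continuous_on (cball (fst \<eta>) (e ?k)) H"
      using at(3)[of ?k] by (intro continuous_on_subset[OF holomorphic_on_imp_continuous_on[OF hol]]) auto
    then show "integrable unit_interval (\<lambda>t. H (fst (\<Phi> \<eta> t)))"
      using integrable_circle[of "fst \<eta>" "e ?k" H] at(3)[of ?k] by (simp add: Phi_eq[OF that(1)] circ_def)
  qed
  have snd_Phi: "snd (\<Phi> \<eta> t) = q (K \<eta>) (fst (\<Phi> \<eta> t))" if "\<eta> \<in> V" for \<eta> t
    using that by (simp add: Phi_eq)
  have snd_eta: "snd \<eta> = q (K \<eta>) (fst \<eta>)" if "\<eta> \<in> V" for \<eta>
    using at(5)[OF KN[OF that]] by simp
  have mean2: "(LINT t|unit_interval. h (\<Phi> \<eta> t)) = h \<eta>"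
    if \<eta>: "\<eta> \<in> V" and h: "holomorphic_slice h hx hy \<rho>" for h hx hy \<eta>
  proof -
    have "(\<lambda>x. h (x, q (K \<eta>) x)) holomorphic_on ball (c (K \<eta>)) (3 * e (K \<eta>))"
      by (intro holomorphic_slice.F_curve_holomorphic[OF h] open_ball holomorphic_on_ident at(4) in_ball)
    from mean(1)[OF \<eta> this] show ?thesis
      by (simp only: snd_Phi[OF \<eta>, symmetric] snd_eta[OF \<eta>, symmetric] prod.collapse)
  qed
  have kap: "(LINT t|unit_interval. \<kappa> (\<Phi> \<eta> t)) = \<kappa> \<eta>" "integrable unit_interval (\<lambda>t. \<kappa> (\<Phi> \<eta> t))" if \<eta>: "\<eta> \<in> V" for \<eta>
  proof -
    let ?B = "ball (c (K \<eta>)) (3 * e (K \<eta>))"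
    have "(\<lambda>x. Fy (x, q (K \<eta>) x)) holomorphic_on ?B"
      by (intro Fy_curve_holomorphic open_ball holomorphic_on_ident at(4) in_ball)
    moreover have "Fy (x, q (K \<eta>) x) \<noteq> 0" if "x \<in> ?B" for x using at(6)[OF that] by (simp add: V_def)
    \<comment> \<open>A zero-free holomorphic function on a disc has a logarithm, so on the chart
      \<open>\<kappa>\<close> is minus the real part of a holomorphic function.\<close>
    ultimately obtain L where L: "L holomorphic_on ?B" "\<And>x. x \<in> ?B \<Longrightarrow> exp (L x) = Fy (x, q (K \<eta>) x)"
      using at(3)[of "K \<eta>"] holomorphic_logarithm_exists[of ?B _ "c (K \<eta>)"] by auto
    have lnexp: "ln (norm (exp w)) = Re w" for w :: complex by simp
    have "fst (\<Phi> \<eta> t) \<in> ?B" for t using circ_in[OF \<eta>] by (simp add: Phi_eq[OF \<eta>])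
    then have 1: "\<kappa> (\<Phi> \<eta> t) = - Re (L (fst (\<Phi> \<eta> t)))" for t
      using Phi_V[OF \<eta>] L(2)[of "fst (\<Phi> \<eta> t)"] by (simp add: \<kappa>_def lnexp[symmetric] snd_Phi[OF \<eta>, symmetric] del: norm_exp_eq_Re)
    have "fst \<eta> \<in> ?B" using at(5)[OF KN[OF \<eta>]] at(3)[of "K \<eta>"] by simp
    then have 2: "\<kappa> \<eta> = - Re (L (fst \<eta>))"
      using \<eta> L(2)[of "fst \<eta>"] by (simp add: \<kappa>_def lnexp[symmetric] snd_eta[OF \<eta>, symmetric] del: norm_exp_eq_Re)
    show "(LINT t|unit_interval. \<kappa> (\<Phi> \<eta> t)) = \<kappa> \<eta>" "integrable unit_interval (\<lambda>t. \<kappa> (\<Phi> \<eta> t))"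
      unfolding 1 2 using mean[OF \<eta> L(1)] by (auto simp: integral_Re)
  qed
  interpret W: exit_walk unit_interval \<Phi> V \<rho> \<kappa>
  proof (intro exit_walk.intro disc_walk.intro prob_space_unit_interval disc_walk_axioms.intro exit_walk_axioms.intro)
    show "\<kappa> \<in> borel_measurable borel"
    proof -
      have "\<kappa> = (\<lambda>z. if z \<in> V then - ln (norm (Fy0 z)) else 0)"
        using V_ball by (auto simp: \<kappa>_def Fy0_def fun_eq_iff)
      also have "\<dots> \<in> borel_measurable borel" by measurable
      finally show ?thesis .
    qed
    show "(LINT t|unit_interval. \<Phi> \<eta> t) = \<eta>" if \<eta>: "\<eta> \<in> V" for \<eta>
    proof (rule prod_eqI)
      interpret U: prob_space unit_interval by (rule prob_space_unit_interval)
      have "(\<lambda>t. (fst (\<Phi> \<eta> t), snd (\<Phi> \<eta> t))) \<in> borel_measurable unit_interval"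
        unfolding snd_Phi[OF \<eta>] using mean(2)[OF \<eta>, of "\<lambda>x. x"] mean(2)[OF \<eta> at(4)]
        by (intro borel_measurable_Pair borel_measurable_integrable) auto
      moreover have "norm (\<Phi> \<eta> t) < \<rho>" for t using subsetD[OF V_ball Phi_V[OF \<eta>]] by simp
      ultimately have i: "integrable unit_interval (\<Phi> \<eta>)"
        by (intro U.integrable_const_bound[of _ \<rho>]) (auto intro!: AE_I2 less_imp_le)
      show "fst (LINT t|unit_interval. \<Phi> \<eta> t) = fst \<eta>"
        using mean(1)[OF \<eta>, of "\<lambda>x. x"] integral_fst[OF i] by (simp add: holomorphic_on_ident)
      show "snd (LINT t|unit_interval. \<Phi> \<eta> t) = snd \<eta>"
        using mean(1)[OF \<eta> at(4)] integral_snd[OF i]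
        by (simp only: snd_Phi[OF \<eta>, symmetric] snd_eta[OF \<eta>, symmetric])
    qed
    fix R assume R: "R < \<rho>"
    \<comment> \<open>The right-hand side increases with \<open>R\<close>, so one step from norm at
      most \<open>R\<close> ends at norm at most \<open>R'\<close>.\<close>
    define R' where "R' = R + 2/3 * (\<rho> - R)"
    have R': "R' < \<rho>" "R < R'" using R by (auto simp: R'_def field_simps)
    have "compact (Fy ` cball 0 R')"
      using R' by (intro compact_continuous_image continuous_on_subset[OF Fy_continuous]) auto
    then have "bounded (Fy ` cball 0 R')" by (rule compact_imp_bounded)
    then obtain B where "\<forall>x\<in>Fy ` cball 0 R'. norm x \<le> B" unfolding bounded_iff by blast
    then have B: "norm (Fy z) \<le> B" if "norm z \<le> R'" for z using that by simp
    have low: "- ln (max B 1) \<le> \<kappa> z" if "z \<in> V" "norm z \<le> R'" for z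
      using that B[of z] by (auto simp: \<kappa>_def V_def intro!: ln_mono max.coboundedI1)
    show "\<exists>M. \<forall>\<eta>\<in>V. norm \<eta> \<le> R \<longrightarrow> - M \<le> \<kappa> \<eta> \<and> (\<forall>t. - M \<le> \<kappa> (\<Phi> \<eta> t))"
    proof (intro exI[of _ "ln (max B 1)"] ballI impI conjI allI)
      fix \<eta> assume \<eta>: "\<eta> \<in> V" "norm \<eta> \<le> R"
      show "- ln (max B 1) \<le> \<kappa> \<eta>" using \<eta> R' by (intro low) auto
      fix t
      have "norm (\<Phi> \<eta> t) \<le> norm \<eta> + 2/3 * (\<rho> - norm \<eta>)"
        unfolding Phi_eq[OF \<eta>(1)] by (intro at(7) KN \<eta> circ_in)
      then have "norm (\<Phi> \<eta> t) \<le> R'" using \<eta>(2) by (simp add: R'_def field_simps)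
      then show "- ln (max B 1) \<le> \<kappa> (\<Phi> \<eta> t)" using Phi_V[OF \<eta>(1)] by (intro low)
    qed
  next
    fix p :: "complex \<times> complex" assume p: "norm p < \<rho>"
    show "(\<exists>\<delta>>0. \<exists>N. open N \<and> p \<in> N \<and> (\<forall>\<eta>\<in>N \<inter> V. \<forall>t. \<delta> \<le> norm (\<Phi> \<eta> t - \<eta>))) \<or>
      (\<forall>L. \<exists>N. open N \<and> p \<in> N \<and> (\<forall>\<eta>\<in>N \<inter> V. L \<le> \<kappa> \<eta>))"
    proof (cases "p \<in> V")
      case True
      then obtain i where i: "p \<in> N i" using at(2) by blast
      define \<delta> where "\<delta> = Min (e ` {..i})"
      have "\<delta> > 0" unfolding \<delta>_def using at(3) by (subst Min_gr_iff) auto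
      moreover have "\<delta> \<le> norm (\<Phi> \<eta> t - \<eta>)" if "\<eta> \<in> N i \<inter> V" for \<eta> t
      proof -
        have "K \<eta> \<le> i" unfolding K_def using that by (auto intro: Least_le)
        then have "\<delta> \<le> e (K \<eta>)" unfolding \<delta>_def by (intro Min_le) auto
        also have "\<dots> = norm (fst (\<Phi> \<eta> t - \<eta>))"
          using that at(3)[of "K \<eta>"] by (simp add: Phi_eq circ_def norm_mult)
        also have "\<dots> \<le> norm (\<Phi> \<eta> t - \<eta>)"
          using norm_fst_le[of "fst (\<Phi> \<eta> t - \<eta>)" "snd (\<Phi> \<eta> t - \<eta>)"] by (simp only: prod.collapse)
        finally show ?thesis .
      qed
      ultimately show ?thesis by (intro disjI1 exI[of _ \<delta>] exI[of _ "N i"] conjI ballI allI at(1) i)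
    next
      case False
      have opn: "open (ball 0 \<rho> \<inter> F -` (- {F z0}))" "open (ball 0 \<rho> \<inter> Fy -` (ball 0 (exp (- L))))" for L
        using continuous_open_preimage[OF contV(1) open_ball open_Compl[OF closed_singleton]]
          continuous_open_preimage[OF contV(2) open_ball open_ball] by auto
      show ?thesis
      proof (cases "F p = F z0")
        case True
        then have g0: "Fy p = 0" using False p by (simp add: V_def)
        have "\<exists>N. open N \<and> p \<in> N \<and> (\<forall>\<eta>\<in>N \<inter> V. L \<le> \<kappa> \<eta>)" for L
        proof (intro exI[of _ "ball 0 \<rho> \<inter> Fy -` (ball 0 (exp (- L)))"] conjI opn ballI)
          fix \<eta> assume \<eta>: "\<eta> \<in> (ball 0 \<rho> \<inter> Fy -` (ball 0 (exp (- L)))) \<inter> V"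
          then have "norm (Fy \<eta>) < exp (- L)" "norm (Fy \<eta>) > 0" by (auto simp: V_def)
          then have "ln (norm (Fy \<eta>)) < - L" by (metis exp_gt_zero ln_exp ln_less_cancel_iff)
          then show "L \<le> \<kappa> \<eta>" using \<eta> by (simp add: \<kappa>_def)
        qed (use p g0 in auto)
        then show ?thesis by blast
      next
        \<comment> \<open>Off the level set a whole neighbourhood of \<open>p\<close> misses
          \<open>V\<close>, and the barrier condition holds vacuously.\<close>
        case neq: False
        have "\<exists>N. open N \<and> p \<in> N \<and> (\<forall>\<eta>\<in>N \<inter> V. L \<le> \<kappa> \<eta>)" for L
          by (intro exI[of _ "ball 0 \<rho> \<inter> F -` (- {F z0})"] conjI opn) (use p neq in \<open>auto simp: V_def\<close>)
        then show ?thesis by blast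
      qed
    qed
  qed (use Phi_m Phi_V V_sets V_ball kap sets_unit_interval in auto)
  obtain r Y where rY: "strict_mono r" "Y \<in> borel_measurable W.S"
    "AE \<omega> in W.S. (\<lambda>n. W.X (r n) z0 \<omega>) \<longlonglongrightarrow> Y \<omega> \<and> norm (Y \<omega>) = \<rho>"
    by (rule W.exit_limit[OF z0V])
  define h' where "h' h z = (if z \<in> V then h z else 0)" for h :: "complex \<times> complex \<Rightarrow> complex" and z
  have harm: "W.harmonic (h' h)" if h: "holomorphic_slice h hx hy \<rho>" and b: "bounded (h ` ball 0 \<rho>)" for h hx hy
    unfolding W.harmonic_def
  proof (intro conjI ballI)
    have "(\<lambda>z. if z \<in> ball 0 \<rho> then h z else 0) \<in> borel_measurable borel"
      using holomorphic_slice.F_continuous[OF h]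
      by (intro borel_measurable_continuous_on_if continuous_on_const; simp)
    then have "(\<lambda>z. if z \<in> V then (if z \<in> ball 0 \<rho> then h z else 0) else 0) \<in> borel_measurable borel" by measurable
    also have "(\<lambda>z. if z \<in> V then (if z \<in> ball 0 \<rho> then h z else 0) else 0) = h' h"
      using V_ball by (auto simp: h'_def fun_eq_iff)
    finally show "h' h \<in> borel_measurable borel" .
    show "bounded (h' h ` V)" using V_ball by (intro bounded_subset[OF b]) (auto simp: h'_def)
    show "(LINT t|unit_interval. h' h (\<Phi> \<eta> t)) = h' h \<eta>" if "\<eta> \<in> V" for \<eta>
      using mean2[OF that h] Phi_V[OF that] that by (simp add: h'_def)
  qed
  have h'X: "h' h (W.X n z0 \<omega>) = h (W.X n z0 \<omega>)" for h n \<omega> using W.X_in[OF z0V] by (simp add: h'_def)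
  show thesis
  proof (rule that[of W.S "\<lambda>n. W.X (r n) z0" Y])
    show "W.X (r n) z0 \<omega> \<in> ball 0 \<rho>" "F (W.X (r n) z0 \<omega>) = F z0" for n \<omega>
      using W.X_in[OF z0V, of "r n" \<omega>] by (auto simp: V_def)
    show "(LINT \<omega>|W.S. h (W.X (r n) z0 \<omega>)) = h z0"
      if "holomorphic_slice h hx hy \<rho>" "bounded (h ` ball 0 \<rho>)" for h hx hy n
      using W.harmonic_X[OF harm[OF that] z0V, of "r n"] z0V by (simp add: h'X) (simp add: h'_def)
    show "(LINT \<omega>|W.S. G (W.X (r n) z0 \<omega>) *\<^sub>R h (W.X (r m) z0 \<omega>)) = (LINT \<omega>|W.S. G (W.X (r n) z0 \<omega>) *\<^sub>R h (W.X (r n) z0 \<omega>))"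
      if "holomorphic_slice h hx hy \<rho>" "bounded (h ` ball 0 \<rho>)" "G \<in> borel_measurable borel" "bounded (range G)" "n \<le> m"
      for h hx hy n m and G :: "complex \<times> complex \<Rightarrow> real"
      using W.harmonic_X_prod[OF harm[OF that(1,2)] z0V that(3) bounded_subset[OF that(4)], of "r n" "r m"]
        strict_mono_leD[OF rY(1) that(5)] by (simp add: h'X image_mono)
  qed (use rY W.S.prob_space_axioms in auto)
qed

end

section \<open>Weak-star convergence\<close>

text \<open>Integrability is bundled with the limit so that the admissible test functions
  \<open>h\<close> form a class suited to induction over sets and integrable functions.\<close>

definition weakly_null_on :: "'a measure \<Rightarrow> (nat \<Rightarrow> 'a \<Rightarrow> complex) \<Rightarrow> ('a \<Rightarrow> complex) \<Rightarrow> bool" where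
  "weakly_null_on M v h \<longleftrightarrow> integrable M h \<and> (\<lambda>n. LINT x|M. v n x * h x) \<longlonglongrightarrow> 0"

lemma integrable_bounded_mult:
  fixes v h :: "'a \<Rightarrow> complex"
  assumes [measurable]: "v \<in> borel_measurable M" and "\<And>x. x \<in> space M \<Longrightarrow> norm (v x) \<le> B" and h: "integrable M h"
  shows "integrable M (\<lambda>x. v x * h x)"
proof (rule Bochner_Integration.integrable_bound[of _ "\<lambda>x. B * norm (h x)"])
  show "AE x in M. norm (v x * h x) \<le> norm (B * norm (h x))"
  proof (rule AE_I2)
    fix x assume "x \<in> space M"
    then have "norm (v x) * norm (h x) \<le> B * norm (h x)" using assms(2) by (intro mult_right_mono) auto
    then show "norm (v x * h x) \<le> norm (B * norm (h x))" by (simp add: norm_mult)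
  qed
qed (use h in auto)

text \<open>The approximations converge to the limit in the mean by domination. As \<open>v\<close>
  is uniformly bounded, replacing the test function by \<open>h m\<close> costs an error that is
  small uniformly in \<open>n\<close>; \<open>m\<close> is fixed before \<open>n\<close> tends to
  infinity.\<close>

lemma weakly_null_on_limit:
  assumes v[measurable]: "\<And>n. v n \<in> borel_measurable M" and B: "\<And>n x. x \<in> space M \<Longrightarrow> norm (v n x) \<le> B"
    and hm: "\<And>m. weakly_null_on M v (h m)" and h: "h' \<in> borel_measurable M"
    and lim: "AE x in M. (\<lambda>m. h m x) \<longlonglongrightarrow> h' x"
    and w: "integrable M w" "\<And>m. AE x in M. norm (h m x) \<le> w x"
  shows "weakly_null_on M v h'"
proof -
  have hi: "integrable M (h m)" for m using hm by (simp add: weakly_null_on_def)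
  note [measurable] = h borel_measurable_integrable[OF hi] borel_measurable_integrable[OF w(1)]
  have h': "integrable M h'"
    by (rule integrable_dominated_convergence[OF _ _ w(1) lim w(2)]) auto
  have "AE x in M. \<forall>m. norm (h m x) \<le> w x" unfolding AE_all_countable using w(2) by blast
  with lim have lim0: "AE x in M. (\<lambda>m. norm (h m x - h' x)) \<longlonglongrightarrow> 0"
    and dom: "AE x in M. norm (h m x - h' x) \<le> 2 * w x" for m
  proof -
    show "AE x in M. (\<lambda>m. norm (h m x - h' x)) \<longlonglongrightarrow> 0"
      using lim by eventually_elim (auto intro: tendsto_norm_zero simp: LIM_zero)
    have "AE x in M. norm (h' x) \<le> w x"
      using lim \<open>AE x in M. \<forall>m. norm (h m x) \<le> w x\<close>
    proof eventually_elim
      case (elim x)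
      then show ?case by (intro LIMSEQ_le_const2[OF tendsto_norm[OF elim(1)]]) auto
    qed
    then show "AE x in M. norm (h m x - h' x) \<le> 2 * w x" using w(2)[of m]
    proof eventually_elim
      case (elim x)
      then show ?case using norm_triangle_ineq4[of "h m x" "h' x"] by linarith
    qed
  qed
  have L1: "(\<lambda>m. LINT x|M. norm (h m x - h' x)) \<longlonglongrightarrow> (LINT x|M. 0)"
    by (rule integral_dominated_convergence[of _ _ _ "\<lambda>x. 2 * w x"]) (use lim0 dom w(1) in auto)
  have "(\<lambda>n. LINT x|M. v n x * h' x) \<longlonglongrightarrow> 0"
  proof (rule LIMSEQ_I)
    fix e :: real assume e: "e > 0"
    define C where "C = \<bar>B\<bar> + 1"
    have C: "C > 0" "\<And>n x. x \<in> space M \<Longrightarrow> norm (v n x) \<le> C"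
    proof -
      show "norm (v n x) \<le> C" if "x \<in> space M" for n x using B[OF that, of n] unfolding C_def by linarith
    qed (simp add: C_def)
    have "e / (2 * C) > 0" using e C by simp
    then obtain m where m: "(LINT x|M. norm (h m x - h' x)) < e / (2 * C)"
      using eventually_happens'[OF sequentially_bot order_tendstoD(2)[OF L1, of "e / (2 * C)"]] by auto
    have "(\<lambda>n. LINT x|M. v n x * h m x) \<longlonglongrightarrow> 0" using hm by (simp add: weakly_null_on_def)
    from LIMSEQ_D[OF this, of "e / 2"] obtain N where
      N: "\<And>n. n \<ge> N \<Longrightarrow> norm (LINT x|M. v n x * h m x) < e / 2" using e by auto
    have "norm ((LINT x|M. v n x * h' x) - 0) < e" if "n \<ge> N" for n
    proof -
      have i: "integrable M (\<lambda>x. v n x * h m x)" "integrable M (\<lambda>x. v n x * (h m x - h' x))"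
        using integrable_bounded_mult[OF v C(2) hi]
          integrable_bounded_mult[OF v C(2) Bochner_Integration.integrable_diff[OF hi h']] by blast+
      have "(LINT x|M. v n x * h' x) = (LINT x|M. v n x * h m x - v n x * (h m x - h' x))"
        by (intro Bochner_Integration.integral_cong) (auto simp: algebra_simps)
      also have "\<dots> = (LINT x|M. v n x * h m x) - (LINT x|M. v n x * (h m x - h' x))"
        by (intro Bochner_Integration.integral_diff i)
      finally have "norm (LINT x|M. v n x * h' x) \<le> norm (LINT x|M. v n x * h m x) + norm (LINT x|M. v n x * (h m x - h' x))"
        by (simp add: norm_triangle_ineq4)
      also have "norm (LINT x|M. v n x * (h m x - h' x)) \<le> (LINT x|M. norm (v n x * (h m x - h' x)))"
        by (rule integral_norm_bound)
      also have "\<dots> \<le> (LINT x|M. C * norm (h m x - h' x))"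
        using C hi h' integrable_norm[OF i(2)] unfolding norm_mult
        by (intro integral_mono) (auto intro!: mult_right_mono)
      also have "\<dots> = C * (LINT x|M. norm (h m x - h' x))" by simp
      also have "\<dots> < C * (e / (2 * C))" using m C by (intro mult_strict_left_mono) auto
      also have "\<dots> = e / 2" using C by simp
      finally show ?thesis using N[OF that] by simp
    qed
    then show "\<exists>N. \<forall>n\<ge>N. norm ((LINT x|M. v n x * h' x) - 0) < e" by blast
  qed
  with h' show ?thesis by (simp add: weakly_null_on_def)
qed

lemma weakly_null_on_add:
  assumes v: "\<And>n. v n \<in> borel_measurable M" and B: "\<And>n x. x \<in> space M \<Longrightarrow> norm (v n x) \<le> B"
    and h: "weakly_null_on M v h" and k: "weakly_null_on M v k"
  shows "weakly_null_on M v (\<lambda>x. h x + k x)"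
proof -
  have i: "integrable M h" "integrable M k" using h k by (auto simp: weakly_null_on_def)
  have "(LINT x|M. v n x * (h x + k x)) = (LINT x|M. v n x * h x) + (LINT x|M. v n x * k x)" for n
    using integrable_bounded_mult[OF v B i(1)] integrable_bounded_mult[OF v B i(2)]
    by (simp add: distrib_left)
  then show ?thesis using h k tendsto_add[of "\<lambda>n. LINT x|M. v n x * h x" 0 _ "\<lambda>n. LINT x|M. v n x * k x" 0]
    by (simp add: weakly_null_on_def)
qed

lemma weakly_null_on_cmult:
  assumes "weakly_null_on M v h"
  shows "weakly_null_on M v (\<lambda>x. c * h x)"
proof -
  have "(LINT x|M. v n x * (c * h x)) = c * (LINT x|M. v n x * h x)" for n
    by (simp add: mult.left_commute flip: integral_mult_right_zero)
  then show ?thesis using assms tendsto_mult_right_zero[of "\<lambda>n. LINT x|M. v n x * h x" sequentially c]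
    by (simp add: weakly_null_on_def)
qed

text \<open>Test functions are enlarged in stages: continuous functions, indicators of closed sets
  as their limits, indicators of Borel sets by the pi-lambda argument, and finally all integrable
  functions.\<close>

lemma weakly_null_on_all:
  fixes M :: "'a::metric_space measure"
  assumes "finite_measure M" and sets_M: "sets M = sets (restrict_space borel C)"
    and v[measurable]: "\<And>n. v n \<in> borel_measurable M" and B: "\<And>n x. x \<in> space M \<Longrightarrow> norm (v n x) \<le> B"
    and cont: "\<And>k :: 'a \<Rightarrow> real. continuous_on UNIV k \<Longrightarrow> range k \<subseteq> {0..1} \<Longrightarrow> weakly_null_on M v (\<lambda>x. of_real (k x))"
    and g: "integrable M g"
  shows "weakly_null_on M v g"
proof -
  interpret finite_measure M by fact
  have id_m[measurable]: "(\<lambda>x. x) \<in> measurable M borel"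
    unfolding measurable_cong_sets[OF sets_M refl] by (intro measurable_restrict_space1) simp
  have ind: "weakly_null_on M v (\<lambda>x. indicator A x)" if "A \<in> sets borel" for A
  proof -
    have bm: "(\<lambda>x. indicator S x :: complex) \<in> borel_measurable M" if "S \<in> sets borel" for S :: "'a set"
      using measurable_compose[OF id_m borel_measurable_indicator[OF that]] .
    have eq: "sets (borel :: 'a measure) = sigma_sets UNIV (Collect closed)" unfolding borel_eq_closed by simp
    have Ist: "Int_stable (Collect closed :: 'a set set)" by (auto simp: Int_stable_def)
    have subset_Pow_UNIV: "Collect closed \<subseteq> Pow (UNIV :: 'a set)" by simp
    show ?thesis
      using Ist subset_Pow_UNIV that[unfolded eq]
    proof (induction rule: sigma_sets_induct_disjoint)
      case (basic A)
      then have A: "closed A" by simp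
      show ?case
      proof (cases "A = {}")
        case True then show ?thesis by (simp add: weakly_null_on_def)
      next
        case False
        \<comment> \<open>Lipschitz functions decreasing to the indicator of \<open>A\<close>;
          closedness gives positive distance off \<open>A\<close>.\<close>
        define k where "k m x = max 0 (1 - real m * infdist x A)" for m x
        show ?thesis
        proof (rule weakly_null_on_limit[OF v B, where h = "\<lambda>m x. of_real (k m x)" and w = "\<lambda>_. 1"])
          show "weakly_null_on M v (\<lambda>x. of_real (k m x))" for m
            by (rule cont) (auto simp: k_def infdist_nonneg intro!: continuous_intros)
          show "AE x in M. (\<lambda>m. complex_of_real (k m x)) \<longlonglongrightarrow> indicator A x"
          proof (rule AE_I2)
            fix x
            show "(\<lambda>m. complex_of_real (k m x)) \<longlonglongrightarrow> indicator A x"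
            proof (cases "x \<in> A")
              case True then show ?thesis by (simp add: k_def)
            next
              case notin: False
              have pos: "infdist x A > 0"
                using notin A False by (metis in_closed_iff_infdist_zero infdist_nonneg less_eq_real_def)
              obtain N where N: "1 < real N * infdist x A" using reals_Archimedean3[OF pos] by blast
              have "k m x = 0" if "m \<ge> N" for m
              proof -
                have "real N * infdist x A \<le> real m * infdist x A" using that pos by (intro mult_right_mono) auto
                then show ?thesis using N by (simp add: k_def)
              qed
              then have "\<forall>\<^sub>F m in sequentially. complex_of_real (k m x) = 0" by (auto simp: eventually_sequentially)
              then show ?thesis using notin by (simp add: tendsto_eventually)
            qed
          qed
          show "AE x in M. norm (complex_of_real (k m x)) \<le> 1" for m
            by (auto simp: k_def infdist_nonneg intro!: AE_I2)
          show "(\<lambda>x. indicator A x :: complex) \<in> borel_measurable M" by (intro bm borel_closed A)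
        qed (auto simp: integrable_const)
      qed
    next
      case empty
      then show ?case by (simp add: weakly_null_on_def)
    next
      case (compl A)
      have 1: "weakly_null_on M v (\<lambda>x. of_real 1)" by (rule cont) auto
      have "weakly_null_on M v (\<lambda>x. of_real 1 + (-1) * indicator A x)"
        by (intro weakly_null_on_add[OF v B] weakly_null_on_cmult 1 compl)
      moreover have "(\<lambda>x. of_real 1 + (-1) * indicator A x) = (indicator (UNIV - A) :: 'a \<Rightarrow> complex)"
        by (auto simp: indicator_def fun_eq_iff)
      ultimately show ?case by simp
    next
      case (union A)
      have fin: "weakly_null_on M v (\<lambda>x. \<Sum>i<m. indicator (A i) x)" for m :: nat
        by (induction m) (auto simp: weakly_null_on_def[of _ _ "\<lambda>_. 0"] intro!: weakly_null_on_add[OF v B] union)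
      have sum_eq: "(\<Sum>i<m. indicator (A i) x) = (indicator (\<Union>i<m. A i) x :: complex)" for m x
        using union(1) by (subst indicator_UN_disjoint) (auto simp: disjoint_family_on_def)
      show ?case
      proof (rule weakly_null_on_limit[OF v B fin, where w = "\<lambda>_. 1"])
        show "AE x in M. (\<lambda>m. \<Sum>i<m. indicator (A i) x) \<longlonglongrightarrow> (indicator (\<Union> (range A)) x :: complex)"
          unfolding sum_eq by (intro AE_I2 LIMSEQ_indicator_UN)
        show "AE x in M. norm (\<Sum>i<m. indicator (A i) x :: complex) \<le> 1" for m
          unfolding sum_eq by (auto simp: indicator_def)
        show "(\<lambda>x. indicator (\<Union> (range A)) x :: complex) \<in> borel_measurable M"
          using union(2) by (intro bm) (auto simp: eq intro!: sigma_sets.Union)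
      qed (auto simp: integrable_const)
    qed
  qed
  show ?thesis
    using g
  proof (induction rule: integrable_induct)
    case (base A c)
    \<comment> \<open>Measurable sets of \<open>M\<close> are traces of Borel sets on
      \<open>C\<close>, and the two indicators agree on the space of \<open>M\<close>.\<close>
    then obtain A' where A': "A' \<in> sets borel" "A = C \<inter> A'" unfolding sets_M by (auto simp: sets_restrict_space)
    have sp: "space M \<subseteq> C" using sets_eq_imp_space_eq[OF sets_M] by (simp add: space_restrict_space)
    have "weakly_null_on M v (\<lambda>x. c * indicator A' x)" by (intro weakly_null_on_cmult ind A')
    moreover have "weakly_null_on M v (\<lambda>x. c * indicator A' x) \<longleftrightarrow> weakly_null_on M v (\<lambda>x. indicator A x *\<^sub>R c)"
      unfolding weakly_null_on_def
      by (intro conj_cong arg_cong[of _ _ "\<lambda>s. s \<longlonglongrightarrow> 0"] ext Bochner_Integration.integrable_cong Bochner_Integration.integral_cong refl)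
        (use sp A'(2) in \<open>auto simp: indicator_def\<close>)
    ultimately show ?case by simp
  next
    case (add f g)
    then show ?case by (intro weakly_null_on_add[OF v B])
  next
    case (lim f s)
    show ?case
      by (rule weakly_null_on_limit[OF v B, where h = s and w = "\<lambda>x. 2 * norm (f x)"]) (use lim in auto)
  qed
qed

section \<open>Representing measures on the sphere\<close>

lemma holomorphic_cn_on_continuous: "holomorphic_cn_on f U \<Longrightarrow> continuous_on U f"
  unfolding holomorphic_cn_on_def
  by (meson continuous_at_imp_continuous_on has_derivative_continuous)

lemma dilate_ball_algebra:
  assumes f: "holomorphic_cn_on f (ball 0 1)" and r: "0 < r" "r < 1"
  shows "dilate f r \<in> ball_algebra"
proof -
  have in_ball: "r *\<^sub>R z \<in> ball 0 1" if "z \<in> cball 0 1" for z :: "complex ^ 'd"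
  proof -
    have "r * norm z \<le> r * 1" using that r by (intro mult_left_mono) auto
    then have "r * norm z < 1" using r by linarith
    then show ?thesis using r by simp
  qed
  have "continuous_on (cball 0 1) (\<lambda>\<zeta>. f (r *\<^sub>R \<zeta>))"
    by (rule continuous_on_compose2[OF holomorphic_cn_on_continuous[OF f]]) (use in_ball in \<open>auto intro!: continuous_intros\<close>)
  moreover have "\<exists>D. ((\<lambda>\<zeta>. f (r *\<^sub>R \<zeta>)) has_derivative D) (at z) \<and> (\<forall>c v. D (c *s v) = c * D v)"
    if "z \<in> ball 0 1" for z
  proof -
    have "\<exists>D. (f has_derivative D) (at (r *\<^sub>R z)) \<and> (\<forall>c v. D (c *s v) = c * D v)"
    proof -
      have "r *\<^sub>R z \<in> ball 0 1" using that by (intro in_ball) simp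
      then show ?thesis using f unfolding holomorphic_cn_on_def by blast
    qed
    then obtain D where D: "(f has_derivative D) (at (r *\<^sub>R z))" "\<And>c v. D (c *s v) = c * D v" by blast
    have "((\<lambda>\<zeta>. r *\<^sub>R \<zeta>) has_derivative (\<lambda>v. r *\<^sub>R v)) (at z)"
      by (auto intro!: derivative_eq_intros)
    from has_derivative_compose[OF this D(1)]
    have "((\<lambda>\<zeta>. f (r *\<^sub>R \<zeta>)) has_derivative (\<lambda>v. D (r *\<^sub>R v))) (at z)" .
    moreover have "D (r *\<^sub>R (c *s v)) = c * D (r *\<^sub>R v)" for c v
    proof -
      have "r *\<^sub>R (c *s v) = c *s (r *\<^sub>R v)" by (simp add: vec_eq_iff)
      then show ?thesis using D(2) by simp
    qed
    ultimately show ?thesis by blast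
  qed
  ultimately show ?thesis
    unfolding ball_algebra_def holomorphic_cn_on_def dilate_def by blast
qed

definition slice :: "complex ^ 'd \<Rightarrow> 'd \<Rightarrow> 'd \<Rightarrow> complex \<times> complex \<Rightarrow> complex ^ 'd" where
  "slice z i j p = (\<chi> k. if k = i then fst p else if k = j then snd p else z $ k)"

lemma slice_self: "slice z i j (z $ i, z $ j) = z"
  by (simp add: slice_def vec_eq_iff)

lemma norm_slice:
  assumes "i \<noteq> j"
  shows "(norm (slice z i j p))\<^sup>2 = (\<Sum>k\<in>UNIV - {i, j}. (norm (z $ k))\<^sup>2) + (norm p)\<^sup>2"
proof -
  have "(norm (slice z i j p))\<^sup>2 = (\<Sum>k\<in>UNIV. (norm (slice z i j p $ k))\<^sup>2)"
    by (simp add: norm_vec_def L2_set_def sum_nonneg)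
  also have "\<dots> = (\<Sum>k\<in>UNIV - {i, j}. (norm (slice z i j p $ k))\<^sup>2) + (\<Sum>k\<in>{i, j}. (norm (slice z i j p $ k))\<^sup>2)"
    by (intro sum.subset_diff) auto
  also have "(\<Sum>k\<in>{i, j}. (norm (slice z i j p $ k))\<^sup>2) = (norm p)\<^sup>2"
    using assms by (simp add: slice_def norm_prod_def)
  also have "(\<Sum>k\<in>UNIV - {i, j}. (norm (slice z i j p $ k))\<^sup>2) = (\<Sum>k\<in>UNIV - {i, j}. (norm (z $ k))\<^sup>2)"
    by (intro sum.cong) (auto simp: slice_def)
  finally show ?thesis .
qed

lemma slice_has_derivative:
  assumes "i \<noteq> j"
  shows "(slice z i j has_derivative (\<lambda>v. fst v *s axis i 1 + snd v *s axis j 1)) (at p)"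
proof -
  let ?J = "\<lambda>v :: complex \<times> complex. fst v *s axis i 1 + snd v *s axis j 1 :: complex ^ 'a"
  have "linear ?J"
    by (rule linearI) (auto simp: vec_eq_iff algebra_simps scaleR_conv_of_real[where 'a = complex])
  then have "(?J has_derivative ?J) (at p)"
    by (intro bounded_linear_imp_has_derivative) (simp add: linear_conv_bounded_linear)
  then have "((\<lambda>p. slice z i j 0 + ?J p) has_derivative ?J) (at p)"
    using has_derivative_add[OF has_derivative_const] by fastforce
  moreover have "(\<lambda>p. slice z i j 0 + ?J p) = slice z i j"
    using assms by (auto simp: fun_eq_iff vec_eq_iff slice_def axis_def)
  ultimately show ?thesis by simp
qed

text \<open>The partial derivatives come from an arbitrary choice of derivative at each point; the
  second conclusion, by uniqueness, ties \<open>hy\<close> to any given derivative and later yields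
  \<open>Fy z0 \<noteq> 0\<close>.\<close>

lemma holomorphic_slice_compose:
  assumes ij: "i \<noteq> j" and h: "holomorphic_cn_on h (ball 0 1)"
    and sl: "\<And>p. p \<in> ball 0 \<rho> \<Longrightarrow> slice z i j p \<in> ball 0 1"
  obtains hx hy where "holomorphic_slice (\<lambda>p. h (slice z i j p)) hx hy \<rho>"
    "\<And>p D. p \<in> ball 0 \<rho> \<Longrightarrow> (h has_derivative D) (at (slice z i j p)) \<Longrightarrow> hy p = D (axis j 1)"
proof -
  define E where "E w = (SOME D. (h has_derivative D) (at w) \<and> (\<forall>c v. D (c *s v) = c * D v))" for w
  have "\<exists>D. (h has_derivative D) (at w) \<and> (\<forall>c v. D (c *s v) = c * D v)" if "w \<in> ball 0 1" for w
    using h that unfolding holomorphic_cn_on_def by blast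
  then have "(h has_derivative E w) (at w) \<and> (\<forall>c v. E w (c *s v) = c * E w v)" if "w \<in> ball 0 1" for w
    unfolding E_def by (rule someI_ex) (rule that)
  then have E: "(h has_derivative E w) (at w)" "\<And>c v. E w (c *s v) = c * E w v" if "w \<in> ball 0 1" for w
    using that by blast+
  show thesis
  proof (rule that[of "\<lambda>p. E (slice z i j p) (axis i 1)" "\<lambda>p. E (slice z i j p) (axis j 1)"])
    show "holomorphic_slice (\<lambda>p. h (slice z i j p)) (\<lambda>p. E (slice z i j p) (axis i 1)) (\<lambda>p. E (slice z i j p) (axis j 1)) \<rho>"
    proof
      fix p :: "complex \<times> complex" assume p: "p \<in> ball 0 \<rho>"
      note E' = E[OF sl[OF p]]
      have "linear (E (slice z i j p))" using E'(1) has_derivative_linear by blast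
      then have "E (slice z i j p) (fst v *s axis i 1 + snd v *s axis j 1) =
        E (slice z i j p) (axis i 1) * fst v + E (slice z i j p) (axis j 1) * snd v" for v
        by (simp add: linear_add E'(2) mult.commute)
      then show "((\<lambda>p. h (slice z i j p)) has_derivative
        (\<lambda>v. E (slice z i j p) (axis i 1) * fst v + E (slice z i j p) (axis j 1) * snd v)) (at p)"
        using has_derivative_compose[OF slice_has_derivative[OF ij] E'(1)] by simp
    qed
    show "E (slice z i j p) (axis j 1) = D (axis j 1)"
      if "p \<in> ball 0 \<rho>" "(h has_derivative D) (at (slice z i j p))" for p D
      using has_derivative_unique[OF E(1)[OF sl[OF that(1)]] that(2)] by simp
  qed
qed

theorem representing_measure_of_noncritical_point:
  fixes f :: "complex ^ 'd \<Rightarrow> complex"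
  assumes card: "CARD('d) \<ge> 2" and f: "f \<in> Hinf" and z: "z \<in> ball 0 1"
    and D: "(f has_derivative D) (at z)" "D v \<noteq> 0"
  shows "\<exists>\<rho>\<in>rep_measures z. weak_star_tendsto \<rho> (dilate f) (\<lambda>_. f z) (at_left 1)"
proof -
  have fh: "holomorphic_cn_on f (ball 0 1)" and fb: "bounded (f ` ball 0 1)" using f by (auto simp: Hinf_def)
  obtain D' where D': "(f has_derivative D') (at z)" "\<And>c v. D' (c *s v) = c * D' v"
    using fh z unfolding holomorphic_cn_on_def by blast
  have DD: "D = D'" using has_derivative_unique[OF D(1) D'(1)] .
  have lin: "linear D" using D(1) has_derivative_linear by blast
  \<comment> \<open>A complex linear map vanishing on all coordinate vectors is zero, so some
    coordinate direction can serve as the second slice variable. A further index \<open>i\<close>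
    exists because the dimension is at least two.\<close>
  obtain j where j: "D (axis j 1) \<noteq> 0"
  proof (rule ccontr)
    assume "\<not> thesis"
    then have 0: "D (axis k 1) = 0" for k using that by blast
    have "v = (\<Sum>k\<in>UNIV. (v $ k) *s axis k 1)" by (simp add: basis_expansion)
    then have "D v = (\<Sum>k\<in>UNIV. D ((v $ k) *s axis k 1))" using linear_sum[OF lin, of "\<lambda>k. (v $ k) *s axis k 1" UNIV] by simp
    also have "\<dots> = 0" using D'(2) 0 by (simp add: DD)
    finally show False using D(2) by simp
  qed
  obtain i :: 'd where ij: "i \<noteq> j"
  proof -
    have "\<not> (UNIV :: 'd set) \<subseteq> {j}" using card card_mono[of "{j}" "UNIV :: 'd set"] by auto
    then show ?thesis using that by blast
  qed
  define N where "N = (\<Sum>k\<in>UNIV - {i, j}. (norm (z $ k))\<^sup>2)"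
  define \<rho> where "\<rho> = sqrt (1 - N)"
  define \<iota> where "\<iota> = slice z i j"
  have N: "(norm (\<iota> p))\<^sup>2 = N + (norm p)\<^sup>2" for p unfolding \<iota>_def N_def by (rule norm_slice[OF ij])
  define z0 where "z0 = (z $ i, z $ j)"
  have \<iota>z0: "\<iota> z0 = z" by (simp add: \<iota>_def z0_def slice_self)
  have "(norm z)\<^sup>2 < 1" using z by (simp add: abs_square_less_1)
  then have "N + (norm z0)\<^sup>2 < 1" using N[of z0] by (simp add: \<iota>z0)
  then have N1: "N < 1" using zero_le_power2[of "norm z0"] by linarith
  have \<rho>: "\<rho> > 0" "\<rho>\<^sup>2 = 1 - N" using N1 by (auto simp: \<rho>_def)
  have lt: "norm (\<iota> p) < 1 \<longleftrightarrow> norm p < \<rho>" for p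
  proof -
    have "norm (\<iota> p) < 1 \<longleftrightarrow> (norm (\<iota> p))\<^sup>2 < 1" by (simp add: abs_square_less_1)
    also have "\<dots> \<longleftrightarrow> (norm p)\<^sup>2 < \<rho>\<^sup>2" using N[of p] \<rho> by auto
    also have "\<dots> \<longleftrightarrow> norm p < \<rho>" using \<rho> by (metis less_imp_le norm_ge_zero power2_less_imp_less power_strict_mono zero_less_numeral)
    finally show ?thesis .
  qed
  have eq1: "norm (\<iota> p) = 1" if "norm p = \<rho>" for p
  proof -
    have "(norm (\<iota> p))\<^sup>2 = 1" using N[of p] \<rho> that by simp
    then show ?thesis by (metis abs_norm_cancel power2_eq_1_iff norm_ge_zero abs_1 abs_minus_cancel)
  qed
  have \<iota>c: "continuous_on UNIV \<iota>"
    unfolding \<iota>_def by (intro continuous_at_imp_continuous_on ballI has_derivative_continuous[OF slice_has_derivative[OF ij]])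
  have sl: "slice z i j p \<in> ball 0 1" if "p \<in> ball 0 \<rho>" for p using lt[of p] that by (simp add: \<iota>_def)
  obtain Fx Fy where F: "holomorphic_slice (\<lambda>p. f (\<iota> p)) Fx Fy \<rho>"
    "\<And>p D. p \<in> ball 0 \<rho> \<Longrightarrow> (f has_derivative D) (at (\<iota> p)) \<Longrightarrow> Fy p = D (axis j 1)"
    by (rule holomorphic_slice_compose[OF ij fh sl, folded \<iota>_def], assumption) (rule that; assumption)
  interpret holomorphic_slice "\<lambda>p. f (\<iota> p)" Fx Fy \<rho> by (rule F(1))
  have z0b: "z0 \<in> ball 0 \<rho>" using lt[of z0] z by (simp add: \<iota>z0)
  have "Fy z0 \<noteq> 0" using F(2)[OF z0b, of D] D(1) j by (simp add: \<iota>z0)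
  obtain P :: "real stream measure" and Xs Y where PX: "prob_space P"
    "\<And>n. Xs n \<in> borel_measurable P" "Y \<in> borel_measurable P"
    "\<And>n \<omega>. Xs n \<omega> \<in> ball 0 \<rho>" "\<And>n \<omega>. f (\<iota> (Xs n \<omega>)) = f (\<iota> z0)"
    "AE \<omega> in P. (\<lambda>n. Xs n \<omega>) \<longlonglongrightarrow> Y \<omega> \<and> norm (Y \<omega>) = \<rho>"
    and mart0: "\<And>h hx hy n. holomorphic_slice h hx hy \<rho> \<Longrightarrow> bounded (h ` ball 0 \<rho>) \<Longrightarrow> (LINT \<omega>|P. h (Xs n \<omega>)) = h z0"
    and mart1: "\<And>h hx hy G n m. holomorphic_slice h hx hy \<rho> \<Longrightarrow> bounded (h ` ball 0 \<rho>) \<Longrightarrow>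
      G \<in> borel_measurable borel \<Longrightarrow> bounded (range G) \<Longrightarrow> n \<le> m \<Longrightarrow>
      (LINT \<omega>|P. (G (Xs n \<omega>) :: real) *\<^sub>R h (Xs m \<omega>)) = (LINT \<omega>|P. G (Xs n \<omega>) *\<^sub>R h (Xs n \<omega>))"
    by (rule level_set_exit[OF z0b \<open>Fy z0 \<noteq> 0\<close>]) (rule that; assumption)
  interpret P: prob_space P by (rule PX(1))
  note [measurable] = PX(2,3)
  have \<iota>m[measurable]: "\<iota> \<in> borel_measurable borel" using \<iota>c by (rule borel_measurable_continuous_onI)
  \<comment> \<open>The limit is on the sphere only almost surely. Redefining it on a null set gives
    a map into the sphere everywhere, as the law on the restricted space requires.\<close>
  define Z where "Z \<omega> = (if norm (\<iota> (Y \<omega>)) = 1 then \<iota> (Y \<omega>) else axis i 1)" for \<omega>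
  have ax: "norm (axis i (1::complex)) = 1"
  proof -
    have "(norm (axis i (1::complex) $ k))\<^sup>2 = (if k = i then 1 else 0)" for k
      by (simp add: axis_def)
    then show ?thesis by (simp add: norm_vec_def L2_set_def)
  qed
  have Z1: "norm (Z \<omega>) = 1" for \<omega> by (simp add: Z_def ax)
  let ?S = "restrict_space borel (sphere (0 :: complex ^ 'd) 1)"
  have Zb: "Z \<in> borel_measurable P" unfolding Z_def by measurable
  have Zm[measurable]: "Z \<in> measurable P ?S"
    using Zb Z1 by (intro measurable_restrict_space2) auto
  define W where "W n \<omega> = \<iota> (Xs n \<omega>)" for n \<omega>
  have W1: "norm (W n \<omega>) < 1" "f (W n \<omega>) = f z" for n \<omega>
    using PX(4)[of n \<omega>] lt PX(5)[of n \<omega>] by (auto simp: W_def \<iota>z0)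
  have W1': "norm (W n \<omega>) \<le> 1" for n \<omega> using W1(1)[of n \<omega>] by simp
  have Wb[measurable]: "W n \<in> borel_measurable P" for n unfolding W_def by measurable
  have Wm: "W n \<in> measurable P (restrict_space borel (cball 0 1))" for n
    using Wb W1' by (intro measurable_restrict_space2) auto
  have WZ: "AE \<omega> in P. (\<lambda>n. W n \<omega>) \<longlonglongrightarrow> Z \<omega>"
    using PX(6)
  proof eventually_elim
    case (elim \<omega>)
    then have "Z \<omega> = \<iota> (Y \<omega>)" using eq1 by (simp add: Z_def)
    moreover have "isCont \<iota> (Y \<omega>)" using \<iota>c unfolding continuous_on_eq_continuous_at[OF open_UNIV] by blast
    ultimately show ?case using elim unfolding W_def by (auto intro: isCont_tendsto_compose)
  qed
  define \<mu> where "\<mu> = distr P ?S Z"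
  have mu_sets: "sets \<mu> = sets ?S" by (simp add: \<mu>_def)
  interpret \<mu>: prob_space \<mu> unfolding \<mu>_def by (rule P.prob_space_distr[OF Zm])
  have meas_ball_alg: "(\<lambda>\<omega>. g (Z \<omega>)) \<in> borel_measurable P" "(\<lambda>\<omega>. g (W n \<omega>)) \<in> borel_measurable P" "g \<in> borel_measurable ?S"
    if "continuous_on (cball 0 1) g" for g :: "complex ^ 'd \<Rightarrow> complex" and n
  proof -
    show gS: "g \<in> borel_measurable ?S"
      using that by (intro borel_measurable_continuous_on_restrict continuous_on_subset[OF that]) auto
    show "(\<lambda>\<omega>. g (Z \<omega>)) \<in> borel_measurable P" by (rule measurable_compose[OF Zm gS])
    show "(\<lambda>\<omega>. g (W n \<omega>)) \<in> borel_measurable P"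
      by (rule measurable_compose[OF Wm borel_measurable_continuous_on_restrict[OF that]])
  qed
  have lim_alg: "AE \<omega> in P. (\<lambda>n. g (W n \<omega>)) \<longlonglongrightarrow> g (Z \<omega>)"
    if "continuous_on (cball 0 1) g" for g :: "complex ^ 'd \<Rightarrow> complex"
    using WZ
  proof eventually_elim
    case (elim \<omega>)
    then show ?case using W1' Z1
      by (intro continuous_on_tendsto_compose[OF that]) auto
  qed
  have bdd_alg: "\<exists>B. \<forall>x\<in>cball 0 1. norm (g x) \<le> B" if "continuous_on (cball 0 1) g" for g :: "complex ^ 'd \<Rightarrow> complex"
    using compact_imp_bounded[OF compact_continuous_image[OF that compact_cball]] by (auto simp: bounded_iff)
  have slice_alg: "\<exists>hx hy. holomorphic_slice (\<lambda>p. g (\<iota> p)) hx hy \<rho>" if "g \<in> ball_algebra" for g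
  proof -
    have gh: "holomorphic_cn_on g (ball 0 1)" using that by (simp add: ball_algebra_def)
    show ?thesis by (rule holomorphic_slice_compose[OF ij gh sl, folded \<iota>_def], assumption) blast
  qed
  have bdd_slice: "bounded ((\<lambda>p. g (\<iota> p)) ` ball 0 \<rho>)" if c: "continuous_on (cball 0 1) g" for g :: "complex ^ 'd \<Rightarrow> complex"
  proof -
    obtain B where B: "\<forall>x\<in>cball 0 1. norm (g x) \<le> B" using bdd_alg[OF c] by blast
    have "norm (g (\<iota> p)) \<le> B" if "p \<in> ball 0 \<rho>" for p using B lt[of p] that by simp
    then show ?thesis unfolding bounded_iff by blast
  qed
  have rep: "\<mu> \<in> rep_measures z"
    unfolding rep_measures_def
  proof (intro CollectI conjI ballI mu_sets \<mu>.prob_space_axioms)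
    fix g :: "complex ^ 'd \<Rightarrow> complex" assume g: "g \<in> ball_algebra"
    then have c: "continuous_on (cball 0 1) g" by (simp add: ball_algebra_def)
    obtain B where B: "\<forall>x\<in>cball 0 1. norm (g x) \<le> B" using bdd_alg[OF c] by blast
    have "(\<lambda>n. LINT \<omega>|P. g (W n \<omega>)) \<longlonglongrightarrow> (LINT \<omega>|P. g (Z \<omega>))"
      using W1' B by (intro integral_dominated_convergence[of _ _ _ "\<lambda>_. B"] meas_ball_alg c lim_alg) auto
    moreover have "(LINT \<omega>|P. g (W n \<omega>)) = g z" for n
      using slice_alg[OF g] mart0[OF _ bdd_slice[OF c], of _ _ n] by (auto simp: W_def \<iota>z0)
    ultimately have "(LINT \<omega>|P. g (Z \<omega>)) = g z" by (simp add: LIMSEQ_const_iff)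
    then show "(LINT \<zeta>|\<mu>. g \<zeta>) = g z"
      unfolding \<mu>_def by (subst integral_distr[OF Zm meas_ball_alg(3)[OF c]])
  qed
  obtain B where B: "\<And>w. norm w < 1 \<Longrightarrow> norm (f w) \<le> B" using fb unfolding bounded_iff by (metis image_eqI mem_ball_0)
  have "weak_star_tendsto \<mu> (dilate f) (\<lambda>_. f z) (at_left 1)"
    unfolding weak_star_tendsto_def
  proof (intro allI impI)
    fix g :: "complex ^ 'd \<Rightarrow> complex" assume g: "integrable \<mu> g"
    \<comment> \<open>Left limits at 1 can be tested on sequences, which is the form needed for
      dominated convergence.\<close>
    show "((\<lambda>r. LINT x|\<mu>. dilate f r x * g x) \<longlongrightarrow> (LINT x|\<mu>. f z * g x)) (at_left 1)"
    proof (rule tendsto_at_left_sequentially[of 0])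
      fix R :: "nat \<Rightarrow> real" assume R: "\<And>n. R n < 1" "\<And>n. 0 < R n" "R \<longlonglongrightarrow> 1"
      define v where "v n x = dilate f (R n) x - f z" for n x
      have dA: "dilate f (R n) \<in> ball_algebra" for n by (rule dilate_ball_algebra[OF fh R(2,1)])
      then have dc: "continuous_on (cball 0 1) (dilate f (R n))" for n by (simp add: ball_algebra_def)
      then have vc: "continuous_on (cball 0 1) (v n)" for n unfolding v_def by (intro continuous_intros)
      have vA: "v n \<in> ball_algebra" for n
      proof -
        have "holomorphic_cn_on (v n) (ball 0 1)"
          unfolding holomorphic_cn_on_def
        proof
          fix w :: "complex ^ 'd" assume "w \<in> ball 0 1"
          then obtain D where "(dilate f (R n) has_derivative D) (at w)" "\<forall>c v. D (c *s v) = c * D v"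
            using dA[of n] unfolding ball_algebra_def holomorphic_cn_on_def by blast
          then show "\<exists>D. (v n has_derivative D) (at w) \<and> (\<forall>c v. D (c *s v) = c * D v)"
            unfolding v_def by (intro exI[of _ D]) (auto intro!: derivative_eq_intros)
        qed
        then show ?thesis using vc by (simp add: ball_algebra_def)
      qed
      have vb: "norm (v n x) \<le> 2 * B" if "norm x \<le> 1" for n x
      proof -
        have "R n * norm x \<le> R n * 1" using that R(2)[of n] by (intro mult_left_mono) auto
        then have "R n * norm x < 1" using R(1)[of n] by linarith
        then have "norm (f (R n *\<^sub>R x)) \<le> B" using R(2)[of n] by (intro B) simp
        then show ?thesis using B[of z] z norm_triangle_ineq4[of "f (R n *\<^sub>R x)" "f z"] by (simp add: v_def dilate_def)
      qed
      have vm: "v n \<in> borel_measurable \<mu>" for n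
        using meas_ball_alg(3)[OF vc] by (simp add: measurable_cong_sets[OF mu_sets refl])
      have vb\<mu>: "norm (v n x) \<le> 2 * B" if "x \<in> space \<mu>" for n x
        using that vb sets_eq_imp_space_eq[OF mu_sets] by (simp add: space_restrict_space)
      have "weakly_null_on \<mu> v g"
      proof (rule weakly_null_on_all[OF _ mu_sets vm vb\<mu> _ g])
        show "finite_measure \<mu>" by unfold_locales
        fix k :: "complex ^ 'd \<Rightarrow> real" assume k: "continuous_on UNIV k" "range k \<subseteq> {0..1}"
        have kb: "norm (k x) \<le> 1" for x using k(2) by (auto simp: image_subset_iff)
        have [measurable]: "k \<in> borel_measurable borel" using k(1) by (rule borel_measurable_continuous_onI)
        have km: "k \<in> borel_measurable ?S" by (rule measurable_restrict_space1) measurable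
        define vP where "vP n \<omega> = v n (Z \<omega>)" for n \<omega>
        have vPm: "vP n \<in> borel_measurable P" for n unfolding vP_def by (rule meas_ball_alg(1)[OF vc])
        have vPb: "norm (vP n \<omega>) \<le> 2 * B" for n \<omega> unfolding vP_def using vb Z1 by simp
        have "weakly_null_on P vP (\<lambda>\<omega>. of_real (k (Z \<omega>)))"
        \<comment> \<open>The test function is frozen at time \<open>m\<close> while the radii tend
          to 1; \<open>weakly_null_on_limit\<close> then justifies letting \<open>m\<close> tend to
          infinity.\<close>
        proof (rule weakly_null_on_limit[OF vPm vPb, where h = "\<lambda>m \<omega>. of_real (k (W m \<omega>))" and w = "\<lambda>_. 1"])
          fix m
          have int: "integrable P (\<lambda>\<omega>. complex_of_real (k (W m \<omega>)))"
            using kb by (intro P.integrable_const_bound[of _ 1]) auto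
          \<comment> \<open>The martingale identity holds at all finite times
            \<open>l \<ge> m\<close>. It carries over to the boundary point because
            \<open>v n\<close>, being a dilation minus a constant, is continuous up to the
            sphere.\<close>
          have step: "(LINT \<omega>|P. vP n \<omega> * of_real (k (W m \<omega>))) = (LINT \<omega>|P. v n (W m \<omega>) * of_real (k (W m \<omega>)))" for n
          proof -
            have lim1: "(\<lambda>l. LINT \<omega>|P. v n (W l \<omega>) * of_real (k (W m \<omega>))) \<longlonglongrightarrow> (LINT \<omega>|P. vP n \<omega> * of_real (k (W m \<omega>)))"
            proof (rule integral_dominated_convergence[of _ _ _ "\<lambda>_. 2 * B * 1"])
              show "AE \<omega> in P. (\<lambda>l. v n (W l \<omega>) * of_real (k (W m \<omega>))) \<longlonglongrightarrow> vP n \<omega> * of_real (k (W m \<omega>))"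
                using lim_alg[OF vc] unfolding vP_def by eventually_elim (auto intro: tendsto_mult_right)
              show "AE \<omega> in P. norm (v n (W l \<omega>) * of_real (k (W m \<omega>))) \<le> 2 * B * 1" for l
                unfolding norm_mult using kb vb[OF W1']
                by (intro AE_I2 mult_mono') auto
            qed (use vPm meas_ball_alg(2)[OF vc] in auto)
            have ev: "\<forall>\<^sub>F l in sequentially. (LINT \<omega>|P. v n (W l \<omega>) * of_real (k (W m \<omega>))) = (LINT \<omega>|P. v n (W m \<omega>) * of_real (k (W m \<omega>)))"
            proof (rule eventually_sequentiallyI[of m])
              fix l assume "m \<le> l"
              obtain hx hy where h: "holomorphic_slice (\<lambda>p. v n (\<iota> p)) hx hy \<rho>" using slice_alg[OF vA] by blast
              have G: "(\<lambda>p. k (\<iota> p)) \<in> borel_measurable borel" "bounded (range (\<lambda>p. k (\<iota> p)))"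
                using kb by (auto simp: bounded_iff)
              show "(LINT \<omega>|P. v n (W l \<omega>) * of_real (k (W m \<omega>))) = (LINT \<omega>|P. v n (W m \<omega>) * of_real (k (W m \<omega>)))"
                using mart1[OF h bdd_slice[OF vc] G \<open>m \<le> l\<close>] by (simp add: W_def scaleR_conv_of_real mult.commute)
            qed
            show ?thesis by (rule LIMSEQ_unique[OF lim1 tendsto_eventually[OF ev]])
          qed
          have "(\<lambda>n. LINT \<omega>|P. v n (W m \<omega>) * of_real (k (W m \<omega>))) \<longlonglongrightarrow> (LINT \<omega>|P. 0)"
          proof (rule integral_dominated_convergence[of _ _ _ "\<lambda>_. 2 * B * 1"])
            show "AE \<omega> in P. (\<lambda>n. v n (W m \<omega>) * of_real (k (W m \<omega>))) \<longlonglongrightarrow> 0"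
            proof (rule AE_I2)
              fix \<omega>
              have "isCont f (W m \<omega>)"
                using holomorphic_cn_on_continuous[OF fh] W1(1)[of m \<omega>] by (simp add: continuous_on_eq_continuous_at)
              moreover have "(\<lambda>n. R n *\<^sub>R W m \<omega>) \<longlonglongrightarrow> 1 *\<^sub>R W m \<omega>" by (intro tendsto_intros R(3))
              ultimately have "(\<lambda>n. f (R n *\<^sub>R W m \<omega>)) \<longlonglongrightarrow> f (W m \<omega>)" by (auto intro: isCont_tendsto_compose)
              then have "(\<lambda>n. v n (W m \<omega>)) \<longlonglongrightarrow> 0"
                unfolding v_def dilate_def using W1(2)[of m \<omega>] by (simp add: LIM_zero_iff)
              then show "(\<lambda>n. v n (W m \<omega>) * of_real (k (W m \<omega>))) \<longlonglongrightarrow> 0" by (rule tendsto_mult_left_zero)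
            qed
            show "AE \<omega> in P. norm (v l (W m \<omega>) * of_real (k (W m \<omega>))) \<le> 2 * B * 1" for l
              unfolding norm_mult using kb vb[OF W1']
              by (intro AE_I2 mult_mono') auto
          qed (use meas_ball_alg(2)[OF vc] in auto)
          then show "weakly_null_on P vP (\<lambda>\<omega>. of_real (k (W m \<omega>)))"
            unfolding weakly_null_on_def using int by (simp add: step)
        next
          show "AE \<omega> in P. (\<lambda>m. complex_of_real (k (W m \<omega>))) \<longlonglongrightarrow> of_real (k (Z \<omega>))"
            using WZ
          proof eventually_elim
            case (elim \<omega>)
            have "isCont k (Z \<omega>)" using k(1) by (simp add: continuous_on_eq_continuous_at)
            then show ?case using elim by (intro tendsto_of_real isCont_tendsto_compose[where g = k])
          qed
          show "(\<lambda>\<omega>. complex_of_real (k (Z \<omega>))) \<in> borel_measurable P" using Zb by measurable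
          show "AE \<omega> in P. norm (complex_of_real (k (W m \<omega>))) \<le> 1" for m using kb by simp
        qed (auto simp: P.integrable_const)
        then show "weakly_null_on \<mu> v (\<lambda>x. of_real (k x))"
          unfolding weakly_null_on_def \<mu>_def vP_def
          using km meas_ball_alg(3)[OF vc] by (simp add: integrable_distr_eq[OF Zm] integral_distr[OF Zm])
      qed
      moreover have "(LINT x|\<mu>. v n x * g x) = (LINT x|\<mu>. dilate f (R n) x * g x) - (LINT x|\<mu>. f z * g x)" for n
      proof -
        have "norm (dilate f (R n) x) \<le> 2 * B + norm (f z)" if "x \<in> space \<mu>" for x
          using vb\<mu>[OF that, of n] norm_triangle_sub[of "dilate f (R n) x" "f z"] by (simp add: v_def)
        then have "integrable \<mu> (\<lambda>x. dilate f (R n) x * g x)"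
          using meas_ball_alg(3)[OF dc] g by (intro integrable_bounded_mult) (auto simp: measurable_cong_sets[OF mu_sets refl])
        then show ?thesis using g by (simp add: v_def left_diff_distrib)
      qed
      ultimately show "(\<lambda>n. LINT x|\<mu>. dilate f (R n) x * g x) \<longlonglongrightarrow> (LINT x|\<mu>. f z * g x)"
        by (simp add: weakly_null_on_def LIM_zero_iff)
    qed simp
  qed
  with rep show ?thesis by blast
qed

text \<open>On the complex line through \<open>p\<close> and \<open>z\<close> the identity theorem
  in one variable applies: the part of the line inside the ball is convex, hence connected, and
  \<open>f\<close> is constant on it near \<open>p\<close>.\<close>

lemma holomorphic_cn_locally_constant:
  assumes f: "holomorphic_cn_on f (ball 0 1)" and p: "ball p \<delta> \<subseteq> ball 0 1" "\<delta> > 0"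
    and const: "\<And>w. w \<in> ball p \<delta> \<Longrightarrow> f w = f p" and z: "z \<in> ball 0 1"
  shows "f z = f p"
proof -
  define d where "d = z - p"
  define A where "A = {t :: complex. p + t *s d \<in> ball 0 1}"
  define \<gamma> where "\<gamma> t = p + t *s d" for t
  have lin: "linear (\<lambda>t. t *s d)"
    by (rule linearI) (auto simp: vec_eq_iff algebra_simps scaleR_conv_of_real[where 'a = complex])
  have \<gamma>': "(\<gamma> has_derivative (\<lambda>t. t *s d)) (at t)" for t
  proof -
    have "((\<lambda>t. t *s d) has_derivative (\<lambda>t. t *s d)) (at t)"
      using lin by (intro bounded_linear_imp_has_derivative) (simp add: linear_conv_bounded_linear)
    from has_derivative_add[OF has_derivative_const this] show ?thesis by (simp add: \<gamma>_def[abs_def])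
  qed
  have \<gamma>c: "continuous_on UNIV \<gamma>"
    by (intro continuous_at_imp_continuous_on ballI has_derivative_continuous[OF \<gamma>'])
  have A: "A = \<gamma> -` ball 0 1" by (auto simp: A_def \<gamma>_def)
  have oA: "open A" unfolding A by (rule open_vimage[OF open_ball \<gamma>c])
  have "convex A" unfolding A
  proof (rule convexI)
    fix s t :: complex and u v :: real
    assume st: "s \<in> \<gamma> -` ball 0 1" "t \<in> \<gamma> -` ball 0 1" "0 \<le> u" "0 \<le> v" "u + v = 1"
    have "\<gamma> (u *\<^sub>R s + v *\<^sub>R t) = (u + v) *\<^sub>R p + u *\<^sub>R (s *s d) + v *\<^sub>R (t *s d)"
      using st(5) by (simp add: \<gamma>_def linear_add[OF lin] linear_scale[OF lin])
    also have "\<dots> = u *\<^sub>R \<gamma> s + v *\<^sub>R \<gamma> t"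
      by (simp add: \<gamma>_def scaleR_add_left scaleR_add_right)
    also have "\<dots> \<in> ball 0 1" using st by (intro convexD[OF convex_ball]) auto
    finally show "u *\<^sub>R s + v *\<^sub>R t \<in> \<gamma> -` ball 0 1" by simp
  qed
  then have cA: "connected A" by (rule convex_connected)
  have hol: "(\<lambda>t. f (\<gamma> t)) holomorphic_on A"
    unfolding holomorphic_on_open[OF oA]
  proof
    fix t assume "t \<in> A"
    then obtain D where D: "(f has_derivative D) (at (\<gamma> t))" "\<And>c v. D (c *s v) = c * D v"
      using f unfolding A holomorphic_cn_on_def by blast
    have "((\<lambda>t. f (\<gamma> t)) has_derivative (\<lambda>s. D (s *s d))) (at t)"
      by (rule has_derivative_compose[OF \<gamma>' D(1)])
    then have "((\<lambda>t. f (\<gamma> t)) has_field_derivative D d) (at t)"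
      unfolding has_field_derivative_def by (rule has_derivative_eq_rhs) (simp add: D(2) fun_eq_iff)
    then show "\<exists>f'. ((\<lambda>t. f (\<gamma> t)) has_field_derivative f') (at t)" by blast
  qed
  define O' where "O' = \<gamma> -` ball p \<delta>"
  have oO: "open O'" unfolding O'_def by (rule open_vimage[OF open_ball \<gamma>c])
  have \<gamma>0: "\<gamma> 0 = p" "\<gamma> 1 = z" by (simp_all add: \<gamma>_def d_def)
  have O: "0 \<in> O'" "O' \<subseteq> A" using p \<gamma>0 by (auto simp: O'_def A)
  have lim0: "(0::complex) islimpt O'" using interior_limit_point[of 0 O'] oO O(1) by (simp add: interior_open)
  have "(\<lambda>t. f (\<gamma> t) - f p) holomorphic_on A" by (intro holomorphic_intros hol)
  moreover have "f (\<gamma> t) - f p = 0" if "t \<in> O'" for t using const[of "\<gamma> t"] that by (simp add: O'_def)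
  moreover have "1 \<in> A" using z \<gamma>0(2) by (simp add: A)
  ultimately have "f (\<gamma> 1) - f p = 0"
    by (rule analytic_continuation[OF _ oA cA O(2) subsetD[OF O(2,1)] lim0])
  then show ?thesis by (simp add: \<gamma>0)
qed

theorem theorem4p5:
  fixes f :: "complex ^ 'd \<Rightarrow> complex"
  assumes "CARD('d) \<ge> 2"
    and "f \<in> Hinf"
  shows "\<exists>\<Lambda> :: complex set.
           \<Lambda> \<subseteq> f ` ball 0 1 \<and> f ` ball 0 1 \<subseteq> closure \<Lambda> \<and>
           (\<forall>a\<in>\<Lambda>. \<exists>\<rho> \<in> (\<Union>z\<in>ball 0 1. rep_measures z).
              weak_star_tendsto \<rho> (dilate f) (\<lambda>_. a) (at_left 1))"
proof (cases "\<forall>z\<in>ball 0 1. f z = f 0")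
  case True
  \<comment> \<open>Any representing measure will do; a coordinate function, which has no critical points, provides one.\<close>
  define j :: 'd where "j = undefined"
  define h where "h z = z $ j" for z :: "complex ^ 'd"
  have h_bl: "bounded_linear h" unfolding h_def by (rule bounded_linear_vec_nth)
  have h': "(h has_derivative h) (at z)" for z by (rule bounded_linear_imp_has_derivative[OF h_bl])
  have "h \<in> Hinf"
    unfolding Hinf_def holomorphic_cn_on_def
  proof (intro CollectI conjI ballI)
    show "\<exists>D. (h has_derivative D) (at z) \<and> (\<forall>c v. D (c *s v) = c * D v)" for z
      by (intro exI[of _ h] conjI h') (simp add: h_def)
    have "norm (h z) \<le> 1" if "z \<in> ball 0 1" for z
      using that Finite_Cartesian_Product.norm_nth_le[of z j] by (simp add: h_def)
    then show "bounded (h ` ball 0 1)" by (intro boundedI[where B = 1]) auto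
  qed
  then obtain \<rho> where \<rho>: "\<rho> \<in> rep_measures (0 :: complex ^ 'd)"
    using representing_measure_of_noncritical_point[OF assms(1) _ _ h'[of 0], of "axis j 1"]
    by (auto simp: h_def)
  have sp: "space \<rho> = sphere 0 1"
    using \<rho> sets_eq_imp_space_eq[of \<rho> "restrict_space borel (sphere 0 1)"]
    by (auto simp: rep_measures_def space_restrict_space)
  have "weak_star_tendsto \<rho> (dilate f) (\<lambda>_. f 0) (at_left 1)"
    unfolding weak_star_tendsto_def
  proof (intro allI impI tendsto_eventually)
    fix g :: "complex ^ 'd \<Rightarrow> complex"
    \<comment> \<open>For such \<open>r\<close> the dilated sphere lies in the open ball, where
      \<open>f\<close> is constant, so the integrals agree before any limit is taken.\<close>
    have "\<forall>\<^sub>F r in at_left (1::real). r \<in> {0<..<1}" by (rule eventually_at_leftI[of 0]) auto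
    then show "\<forall>\<^sub>F r in at_left 1. (LINT x|\<rho>. dilate f r x * g x) = (LINT x|\<rho>. f 0 * g x)"
    proof eventually_elim
      case (elim r)
      show ?case
      proof (rule Bochner_Integration.integral_cong[OF refl])
        fix x assume "x \<in> space \<rho>"
        then have "r *\<^sub>R x \<in> ball 0 1" using elim by (simp add: sp)
        then show "dilate f r x * g x = f 0 * g x"
          using bspec[OF True] by (simp only: dilate_def)
      qed
    qed
  qed
  then have "\<exists>\<rho>\<in>(\<Union>z\<in>ball 0 1. rep_measures z). weak_star_tendsto \<rho> (dilate f) (\<lambda>_. f 0) (at_left 1)"
    using \<rho> by (intro bexI[of _ \<rho>] UN_I[of 0]) auto
  moreover have "f ` ball 0 1 \<subseteq> {f 0}" using bspec[OF True] by blast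
  moreover have "{f 0} \<subseteq> f ` ball 0 1" by simp
  ultimately show ?thesis by (intro exI[of _ "{f 0}"]) simp
next
  case False
  have fh: "holomorphic_cn_on f (ball 0 1)" using assms(2) by (simp add: Hinf_def)
  define R where "R = {z \<in> ball 0 1. \<exists>D v. (f has_derivative D) (at z) \<and> D v \<noteq> 0}"
  \<comment> \<open>Near a point outside \<open>closure R\<close> the derivative vanishes, so
    \<open>f\<close> is constant there and then on the whole ball, against the case assumption.
    Continuity of \<open>f\<close> carries density from points to values.\<close>
  have dense: "ball 0 1 \<subseteq> closure R"
  proof (rule subsetI, rule ccontr)
    fix p assume p: "p \<in> ball 0 1" "p \<notin> closure R"
    then have "open (ball 0 1 - closure R)" "p \<in> ball 0 1 - closure R" by auto
    then obtain \<delta> where \<delta>: "\<delta> > 0" "ball p \<delta> \<subseteq> ball 0 1 - closure R" using open_contains_ball by blast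
    have sub: "ball p \<delta> \<subseteq> ball 0 1" using \<delta>(2) by blast
    have const: "f w = f p" if "w \<in> ball p \<delta>" for w
    proof (rule has_derivative_zero_unique_connected[of "ball p \<delta>" f])
      fix x assume x: "x \<in> ball p \<delta>"
      then have "x \<in> ball 0 1" "x \<notin> R" using \<delta>(2) closure_subset[of R] by blast+
      then obtain D where D: "(f has_derivative D) (at x)" using fh unfolding holomorphic_cn_on_def by blast
      then have "D = (\<lambda>v. 0)" using \<open>x \<in> ball 0 1\<close> \<open>x \<notin> R\<close> by (auto simp: R_def)
      with D show "(f has_derivative (\<lambda>v. 0)) (at x)" by simp
    qed (use that \<delta> in auto)
    have fp: "f z = f p" if "z \<in> ball 0 1" for z
      by (rule holomorphic_cn_locally_constant[OF fh sub \<delta>(1) const that])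
    have "f z = f 0" if "z \<in> ball 0 1" for z using fp[OF that] fp[of 0] by simp
    then show False using False by blast
  qed
  have fR: "f ` ball 0 1 \<subseteq> closure (f ` R)"
  proof
    fix y assume "y \<in> f ` ball 0 1"
    then obtain z where z: "z \<in> ball 0 1" "y = f z" by blast
    then obtain s where s: "\<And>n. s n \<in> R" "s \<longlonglongrightarrow> z"
      using dense closure_sequential[of z R] by blast
    have "isCont f z" using holomorphic_cn_on_continuous[OF fh] z(1) by (simp add: continuous_on_eq_continuous_at)
    then have "(\<lambda>n. f (s n)) \<longlonglongrightarrow> f z" using s(2) by (rule isCont_tendsto_compose)
    then show "y \<in> closure (f ` R)" unfolding closure_sequential z(2)
      by (intro exI[of _ "\<lambda>n. f (s n)"] conjI allI imageI s(1))
  qed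
  have rho: "\<exists>\<rho>\<in>(\<Union>z\<in>ball 0 1. rep_measures z). weak_star_tendsto \<rho> (dilate f) (\<lambda>_. a) (at_left 1)"
    if "a \<in> f ` R" for a
  proof -
    obtain z D v where z: "z \<in> ball 0 1" "(f has_derivative D) (at z)" "D v \<noteq> 0" "a = f z"
      using \<open>a \<in> f ` R\<close> by (auto simp: R_def)
    obtain \<rho> where "\<rho> \<in> rep_measures z" "weak_star_tendsto \<rho> (dilate f) (\<lambda>_. a) (at_left 1)"
      using representing_measure_of_noncritical_point[OF assms z(1-3)] unfolding z(4) by blast
    then show ?thesis using z(1) by (intro bexI[of _ \<rho>] UN_I[of z])
  qed
  have "f ` R \<subseteq> f ` ball 0 1" by (auto simp: R_def)
  then show ?thesis by (intro exI[of _ "f ` R"] conjI ballI fR rho)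
qed

end
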